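(* Let $\mu$ be a probability measure on the unit circle (identified with $\mathbb{R}/(2\pi\mathbb{Z})$) that is not supported on a finite number of points, and let $\{\alpha_n\}_{n\ge 0}$ be its Verblunsky coefficients. Suppose there is $A\le \tfrac14$ such that $$\sum_{n=0}^{N}(n+1)|\alpha_n|^2\le A\log N\qquad\text{for all integers } N\ge 2 .$$ Then $\mu_{\rm sing}=0$, i.e. $\mu$ is absolutely continuous with respect to Lebesgue measure.
   Context: Let $\mu$ be a probability measure on $\mathbb{R}/(2\pi\mathbb{Z})$ not supported on finitely many points. Its monic orthogonal polynomials $\Phi_n(z)$ (monic of degree $n$, orthogonal in $L^2(\mu)$ when evaluated at $z=e^{i\eta}$) obey $\Phi_0=1$ and the Szegő recursion $\Phi_{n+1}(z)=z\Phi_n(z)-\overline{\alpha_n}\,\Phi_n^*(z)$, where $\Phi_n^*(z)=z^n\overline{\Phi_n(1/\overline z)}$. The numbers $\alpha_n\in\mathbb{D}=\{z\in\mathbb{C}:|z|<1\}$, $n\ge 0$, are the Verblunsky coefficients of $\mu$; conversely every sequence in $\mathbb{D}$ arises from a unique such measure. The Lebesgue decomposition is $\mu=\mu_{\rm ac}+\mu_{\rm sc}+\mu_{\rm pp}$ into absolutely continuous (with respect to Lebesgue measure), singular continuous and pure point parts, and $\mu_{\rm sing}=\mu_{\rm sc}+\mu_{\rm pp}$. *)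

theory Defs
  imports "HOL-Probability.Probability" "HOL-Computational_Algebra.Polynomial"
begin

text \<open>The circle of angles modulo \<open>2\<pi>\<close> is the unit circle in the complex plane, via \<^const>\<open>cis\<close>.\<close>

definition circle_borel :: "complex measure" where
  "circle_borel = restrict_space borel (sphere 0 1)"

definition circle_lebesgue :: "complex measure" where
  "circle_lebesgue = distr (restrict_space lborel {0..<2 * pi}) circle_borel cis"

lemma measurable_cis_circle: "cis \<in> measurable (restrict_space lborel {0..<2 * pi}) circle_borel"
proof -
  have "cis \<in> borel_measurable borel"
    by (intro borel_measurable_continuous_onI continuous_intros)
  then have "cis \<in> measurable (restrict_space lborel {0..<2 * pi}) borel"
    by (intro measurable_restrict_space1) simp
  then show ?thesis
    unfolding circle_borel_def by (intro measurable_restrict_space2) (auto simp: dist_norm)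
qed

definition finitely_supported :: "'a measure \<Rightarrow> bool" where
  "finitely_supported M \<longleftrightarrow> (\<exists>F. finite F \<and> (AE z in M. z \<in> F))"

definition monic_orthogonal_polys :: "complex measure \<Rightarrow> (nat \<Rightarrow> complex poly) \<Rightarrow> bool" where
  "monic_orthogonal_polys M \<Phi> \<longleftrightarrow>
     (\<forall>n. degree (\<Phi> n) = n \<and> lead_coeff (\<Phi> n) = 1) \<and>
     (\<forall>m n. m \<noteq> n \<longrightarrow> (\<integral>z. poly (\<Phi> m) z * cnj (poly (\<Phi> n) z) \<partial>M) = 0)"

definition szego_reversed :: "nat \<Rightarrow> complex poly \<Rightarrow> complex \<Rightarrow> complex" where
  "szego_reversed n P z = z ^ n * cnj (poly P (1 / cnj z))"

text \<open>The formula for the reversed polynomial is only meaningful for \<open>z \<noteq> 0\<close>, so the recursion,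
  an identity between polynomials, is stated there.\<close>

definition verblunsky_coefficients :: "complex measure \<Rightarrow> (nat \<Rightarrow> complex) \<Rightarrow> bool" where
  "verblunsky_coefficients M \<alpha> \<longleftrightarrow>
     (\<exists>\<Phi>. monic_orthogonal_polys M \<Phi> \<and>
       (\<forall>n z. z \<noteq> 0 \<longrightarrow>
         poly (\<Phi> (Suc n)) z = z * poly (\<Phi> n) z - cnj (\<alpha> n) * szego_reversed n (\<Phi> n) z))"

definition lebesgue_decomposition ::
    "complex measure \<Rightarrow> complex measure \<Rightarrow> complex measure \<Rightarrow> complex measure \<Rightarrow> bool" where
  "lebesgue_decomposition M ac sc pp \<longleftrightarrow>
     sets ac = sets M \<and> sets sc = sets M \<and> sets pp = sets M \<and>
     (\<forall>B\<in>sets M. emeasure M B = emeasure ac B + emeasure sc B + emeasure pp B) \<and>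
     absolutely_continuous circle_lebesgue ac \<and>
     (\<exists>N\<in>null_sets circle_lebesgue. emeasure sc (space M - N) = 0) \<and>
     (\<forall>z\<in>space M. emeasure sc {z} = 0) \<and>
     (\<exists>C. countable C \<and> C \<subseteq> space M \<and> emeasure pp (space M - C) = 0)"

definition is_singular_part :: "complex measure \<Rightarrow> complex measure \<Rightarrow> bool" where
  "is_singular_part M s \<longleftrightarrow>
     sets s = sets M \<and>
     (\<exists>ac sc pp. lebesgue_decomposition M ac sc pp \<and>
       (\<forall>B\<in>sets M. emeasure s B = emeasure sc B + emeasure pp B))"

end

theory Submission
  imports Defs
begin

text \<open>
  Write \<open>\<Phi>\<^sub>n\<^sup>*\<close> for the reversed polynomials; on the circle \<open>|\<Phi>\<^sub>n\<^sup>*| = |\<Phi>\<^sub>n|\<close> and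
  \<open>\<Phi>\<^sub>n\<^sub>+\<^sub>1\<^sup>* = \<Phi>\<^sub>n\<^sup>* - \<alpha>\<^sub>n z \<Phi>\<^sub>n\<close>. Since \<open>\<alpha>\<^sub>n\<close> tends to 0, the measures \<open>|\<Phi>\<^sub>n|\<^sup>2 d\<mu>\<close> become proportional to
  Lebesgue measure, so \<open>\<Phi>\<^sub>n\<^sup>*\<close> tends to 0 in \<open>L\<^sup>2(\<mu>)\<close> on a compact Lebesgue null set \<open>K\<close>. By
  orthogonality its squared norm on \<open>K\<close> is bounded by a multiple of the tail sum of \<open>|\<alpha>\<^sub>m|\<^sup>2\<close> over
  \<open>m \<ge> n\<close>, which is \<open>O(log n / n)\<close>. Hence at almost every point of \<open>K\<close>, along \<open>n = 2\<^sup>j\<close>,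
  \<open>- log |\<Phi>\<^sub>n|\<^sup>2 \<ge> 3/4 log n - O(1)\<close>.

  On the other hand \<open>- log |\<Phi>\<^sub>N|\<^sup>2 \<le> 2 \<Sum> Re (\<alpha>\<^sub>n B\<^sub>n) + O(1)\<close> with the unimodular
  \<open>B\<^sub>n = z \<Phi>\<^sub>n / \<Phi>\<^sub>n\<^sup>*\<close>. At two distinct points these phases rotate relative to each other, so
  \<open>|B\<^sub>n + B\<^sub>n'|\<^sup>2\<close> is 2 on logarithmic average, and the arithmetic-geometric mean inequality bounds
  the two values of \<open>- log |\<Phi>\<^sub>N|\<^sup>2\<close> together by \<open>(3/4 + 2/3) log N + O(1)\<close>, which is less than
  \<open>3/2 log N\<close>. So \<open>\<mu>\<close> restricted to \<open>K\<close> lives on a single point. For one point the same argument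
  gives \<open>|\<Phi>\<^sub>N|\<^sup>2 \<ge> c / N\<close>, which is not summable, so that there are no atoms.
\<close>

section \<open>The Szego recursion at a fixed point\<close>

lemma weighted_am_gm:
  fixes a b :: real
  assumes "t > 0"
  shows "2 * a * b \<le> t * a\<^sup>2 + b\<^sup>2 / t"
proof -
  have "t * a\<^sup>2 + b\<^sup>2 / t - 2 * a * b = (t * a - b)\<^sup>2 / t"
    using assms by (simp add: field_simps power2_eq_square)
  also have "\<dots> \<ge> 0" using assms by simp
  finally show ?thesis by simp
qed

text \<open>With \<open>y\<close> the squared modulus and \<open>t = 1 - y\<close>, the bound
  \<open>ln s \<le> s - 1\<close> at \<open>s = 1 / y\<close> gives
  \<open>- ln y \<le> t + t^2 / y\<close>, where \<open>t\<close> is \<open>2 * Re w\<close> minus a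
  square. The constant is 25 = 4 * (5/2)^2, from \<open>y \<ge> 1/4\<close> and
  \<open>\<bar>t\<bar> \<le> 5/2 * cmod w\<close>.\<close>

lemma neg_ln_one_minus_le:
  assumes "cmod w \<le> 1 / 2"
  shows "- ln ((cmod (1 - w))\<^sup>2) \<le> 2 * Re w + 25 * (cmod w)\<^sup>2"
proof -
  define y where "y = (cmod (1 - w))\<^sup>2"
  define t where "t = 1 - y"
  have "1 / 2 \<le> cmod (1 - w)"
    using norm_triangle_ineq2[of 1 w] assms by simp
  then have "(1/2)\<^sup>2 \<le> y" unfolding y_def by (intro power_mono) auto
  then have y: "y \<ge> 1 / 4" by (simp add: power2_eq_square)
  have t: "t = 2 * Re w - (cmod w)\<^sup>2"
    unfolding t_def y_def cmod_power2 by (simp add: power2_eq_square algebra_simps)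
  have "- ln y = ln (1 / y)" using y by (simp add: ln_div)
  also have "\<dots> \<le> 1 / y - 1" by (rule ln_le_minus_one) (use y in auto)
  also have "\<dots> = t + t\<^sup>2 / y" using y by (simp add: t_def field_simps power2_eq_square)
  also have "t\<^sup>2 / y \<le> t\<^sup>2 / (1/4)" using y by (intro divide_left_mono) auto
  also have "t\<^sup>2 \<le> (5/2 * cmod w)\<^sup>2"
  proof (rule abs_le_square_iff[THEN iffD1])
    have "\<bar>Re w\<bar> \<le> cmod w" by (rule abs_Re_le_cmod)
    moreover have "(cmod w)\<^sup>2 \<le> 1/2 * cmod w"
      unfolding power2_eq_square using assms by (intro mult_right_mono) auto
    moreover have "0 \<le> (cmod w)\<^sup>2" by simp
    ultimately show "\<bar>t\<bar> \<le> \<bar>5/2 * cmod w\<bar>" unfolding t using norm_ge_zero[of w] by linarith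
  qed
  finally have "- ln y \<le> t + 25 * (cmod w)\<^sup>2" by (simp add: power2_eq_square)
  then show ?thesis unfolding y_def[symmetric] using t zero_le_power2[of "cmod w"] by linarith
qed

lemma harm_le_ln:
  assumes "N \<ge> 1"
  shows "(\<Sum>n<N. 1 / (real n + 1)) \<le> 1 + ln (real N)"
proof -
  have "(\<Sum>n<N. 1 / (real n + 1)) = harm N"
    by (simp add: harm_altdef inverse_eq_divide add.commute)
  also have "\<dots> \<le> 1 + ln (real N)"
    using euler_mascheroni_sequence_decreasing[of 1 N] assms by (simp add: harm_expand)
  finally show ?thesis .
qed

section \<open>Size of the Verblunsky coefficients and of their dyadic tails\<close>

locale coulomb_decay =
  fixes \<alpha> :: "nat \<Rightarrow> complex"
  assumes coulomb: "N \<ge> 2 \<Longrightarrow> (\<Sum>n=0..N. (real n + 1) * (cmod (\<alpha> n))\<^sup>2) \<le> ln (real N) / 4"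
begin

lemma weighted_sum_le:
  assumes "N \<ge> 2"
  shows "(\<Sum>n<N. (real n + 1) * (cmod (\<alpha> n))\<^sup>2) \<le> ln (real N) / 4"
proof -
  have "(\<Sum>n<N. (real n + 1) * (cmod (\<alpha> n))\<^sup>2) \<le> (\<Sum>n=0..N. (real n + 1) * (cmod (\<alpha> n))\<^sup>2)"
    by (intro sum_mono2) auto
  then show ?thesis using coulomb[OF assms] by simp
qed

text \<open>A single term of the weighted sum suffices, taken at \<open>N = max n 2\<close> because
  the hypothesis starts at 2; there \<open>ln N \<le> N - 1 \<le> n + 1\<close>. The value 1/2 keeps
  the factors \<open>1 - \<alpha> n * B n\<close> of the recursion away from 0.\<close>

lemma alpha_le_half: "cmod (\<alpha> n) \<le> 1 / 2"
proof -
  define N where "N = max n 2"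
  have "(real n + 1) * (cmod (\<alpha> n))\<^sup>2 \<le> (\<Sum>n=0..N. (real n + 1) * (cmod (\<alpha> n))\<^sup>2)"
    by (rule member_le_sum) (auto simp: N_def)
  also have "\<dots> \<le> ln (real N) / 4" by (rule coulomb) (simp add: N_def)
  also have "\<dots> \<le> (real n + 1) / 4"
  proof -
    have "ln (real N) \<le> real N - 1" by (rule ln_le_minus_one) (simp add: N_def)
    also have "\<dots> \<le> real n + 1" by (simp add: N_def)
    finally show ?thesis by simp
  qed
  finally have "(real n + 1) * (cmod (\<alpha> n))\<^sup>2 \<le> (real n + 1) * (1 / 4)" by simp
  then have "(cmod (\<alpha> n))\<^sup>2 \<le> (1 / 2)\<^sup>2"
    by (subst (asm) mult_le_cancel_left_pos) (auto simp: power2_eq_square)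
  then show ?thesis by (rule power2_le_imp_le) simp
qed

text \<open>On the block the weight \<open>n + 1\<close> is at least \<open>2^j\<close>, so the
  weighted bound at \<open>N = 2^Suc j\<close> can be divided by \<open>2^j\<close>.\<close>

lemma dyadic_block_le:
  assumes "j \<ge> 1"
  shows "(\<Sum>n\<in>{2^j..<2^Suc j}. (cmod (\<alpha> n))\<^sup>2) \<le> (real j + 1) / 2^(j+2)"
proof -
  have "2^j * (\<Sum>n\<in>{2^j..<2^Suc j}. (cmod (\<alpha> n))\<^sup>2)
      \<le> (\<Sum>n\<in>{2^j..<2^Suc j}. (real n + 1) * (cmod (\<alpha> n))\<^sup>2)"
    unfolding sum_distrib_left
  proof (intro sum_mono mult_right_mono)
    fix n :: nat assume "n \<in> {2^j..<2^Suc j}"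
    then have "2^j \<le> n" by simp
    then have "real (2^j) \<le> real n" by (simp only: of_nat_le_iff)
    then have "2^j \<le> real n" by (simp only: of_nat_power of_nat_numeral)
    then show "2^j \<le> real n + 1" by linarith
  qed auto
  also have "\<dots> \<le> (\<Sum>n<2^Suc j. (real n + 1) * (cmod (\<alpha> n))\<^sup>2)"
    by (intro sum_mono2) auto
  also have "\<dots> \<le> ln (real (2^Suc j)) / 4"
    by (intro weighted_sum_le) (use assms in simp)
  also have "ln (real (2^Suc j)) = (real j + 1) * ln 2"
    by (simp add: ln_realpow algebra_simps flip: power_Suc)
  also have "\<dots> / 4 \<le> (real j + 1) * 1 / 4"
    using ln_2_less_1 by (intro divide_right_mono mult_left_mono) auto
  finally show ?thesis by (simp add: field_simps)
qed

text \<open>The block bounds telescope exactly: \<open>(k+1) / 2^(k+2)\<close> equals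
  \<open>(k+2) / 2^(k+1) - (k+3) / 2^(k+2)\<close>. The induction carries the subtracted boundary
  term, which is dropped at the end.\<close>

lemma dyadic_tail_le:
  assumes "j \<ge> 1" "j \<le> k"
  shows "(\<Sum>n\<in>{2^j..<2^k}. (cmod (\<alpha> n))\<^sup>2) \<le> (real j + 2) / 2^(j+1)"
proof -
  have "(\<Sum>n\<in>{2^j..<2^k}. (cmod (\<alpha> n))\<^sup>2) \<le> (real j + 2) / 2^(j+1) - (real k + 2) / 2^(k+1)"
    using assms(2)
  proof (induction k rule: dec_induct)
    case base
    then show ?case by simp
  next
    case (step k)
    have "(\<Sum>n\<in>{2^j..<2^Suc k}. (cmod (\<alpha> n))\<^sup>2)
        = (\<Sum>n\<in>{2^j..<2^k}. (cmod (\<alpha> n))\<^sup>2) + (\<Sum>n\<in>{2^k..<2^Suc k}. (cmod (\<alpha> n))\<^sup>2)"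
      using step.hyps by (intro sum.atLeastLessThan_concat[symmetric]) auto
    also have "\<dots> \<le> ((real j + 2) / 2^(j+1) - (real k + 2) / 2^(k+1)) + (real k + 1) / 2^(k+2)"
      using step assms by (intro add_mono dyadic_block_le) auto
    also have "\<dots> = (real j + 2) / 2^(j+1) - (real (Suc k) + 2) / 2^(Suc k+1)"
      by (simp add: field_simps)
    finally show ?case .
  qed
  also have "\<dots> \<le> (real j + 2) / 2^(j+1)" by simp
  finally show ?thesis .
qed

lemma alpha_square_summable: "summable (\<lambda>n. (cmod (\<alpha> n))\<^sup>2)"
proof (rule bounded_imp_summable)
  fix n :: nat
  have "(\<Sum>m\<le>n. (cmod (\<alpha> m))\<^sup>2) \<le> (\<Sum>m<2^(Suc n). (cmod (\<alpha> m))\<^sup>2)"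
  proof (intro sum_mono2)
    show "{..n} \<subseteq> {..<2^Suc n}"
      using less_exp[of "Suc n"] by (auto intro: le_less_trans Suc_lessD)
  qed auto
  also have "\<dots> = (\<Sum>m<2^1. (cmod (\<alpha> m))\<^sup>2) + (\<Sum>m\<in>{2^1..<2^(Suc n)}. (cmod (\<alpha> m))\<^sup>2)"
    unfolding lessThan_atLeast0
    by (intro sum.atLeastLessThan_concat[symmetric]) (auto simp: self_le_power)
  also have "\<dots> \<le> (\<Sum>m<2^1. (cmod (\<alpha> m))\<^sup>2) + (real 1 + 2) / 2^(1+1)"
    by (intro add_left_mono dyadic_tail_le) auto
  finally show "(\<Sum>m\<le>n. (cmod (\<alpha> m))\<^sup>2) \<le> (\<Sum>m<2^1. (cmod (\<alpha> m))\<^sup>2) + (real 1 + 2) / 2^(1+1)" .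
qed auto

definition alpha_sq where "alpha_sq = (\<Sum>n. (cmod (\<alpha> n))\<^sup>2)"

lemma sum_alpha_square_le: "finite I \<Longrightarrow> (\<Sum>n\<in>I. (cmod (\<alpha> n))\<^sup>2) \<le> alpha_sq"
  unfolding alpha_sq_def by (intro sum_le_suminf alpha_square_summable) auto

lemma alpha_tendsto_0: "\<alpha> \<longlonglongrightarrow> 0"
proof -
  have "(\<lambda>n. sqrt ((cmod (\<alpha> n))\<^sup>2)) \<longlonglongrightarrow> sqrt 0"
    by (intro tendsto_real_sqrt summable_LIMSEQ_zero alpha_square_summable)
  then show ?thesis by (simp add: tendsto_norm_zero_iff)
qed

end

section \<open>Modulus and phase along one orbit\<close>

locale szego_orbit = coulomb_decay +
  fixes z :: complex and x :: "nat \<Rightarrow> complex"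
  assumes z: "cmod z = 1"
    and x_0: "x 0 = 1"
    and x_Suc: "x (Suc n) = z * x n - cnj (\<alpha> n) * (z^n * cnj (x n))"
begin

text \<open>When \<open>x\<close> lists the values of the orthogonal polynomials at
  \<open>z\<close>, this is the value of the reversed polynomial. \<open>B\<close> is then the
  Pruefer phase, the unimodular ratio that drives the modulus through the factors
  \<open>cmod (1 - \<alpha> n * B n)\<close>.\<close>

definition v where "v n = z^n * cnj (x n)"
definition B where "B n = z * x n / v n"

lemma norm_v: "cmod (v n) = cmod (x n)"
  by (simp add: v_def norm_mult norm_power z)

lemma z_cnj: "z * cnj z = 1"
  using z complex_norm_square[of z] by simp

lemma v_Suc: "v (Suc n) = v n - \<alpha> n * z * x n"
proof -
  have "v (Suc n) = (z * cnj z) * v n - \<alpha> n * z * (z * cnj z)^n * x n"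
    unfolding power_mult_distrib by (simp add: v_def x_Suc algebra_simps)
  then show ?thesis by (simp add: z_cnj)
qed

lemma norm_step:
  assumes "x n \<noteq> 0"
  shows "cmod (B n) = 1" "v (Suc n) = v n * (1 - \<alpha> n * B n)" "x (Suc n) = v n * (B n - cnj (\<alpha> n))"
proof -
  have v: "v n \<noteq> 0" using assms norm_v[of n] by auto
  show "cmod (B n) = 1" using assms v by (simp add: B_def norm_mult norm_divide z norm_v)
  show "v (Suc n) = v n * (1 - \<alpha> n * B n)" using v by (simp add: v_Suc B_def field_simps)
  show "x (Suc n) = v n * (B n - cnj (\<alpha> n))" using v unfolding x_Suc by (simp add: B_def v_def field_simps)
qed

lemma norm_alpha_B:
  assumes "x n \<noteq> 0"
  shows "cmod (\<alpha> n * B n) = cmod (\<alpha> n)" "cmod (1 - \<alpha> n * B n) \<ge> 1 / 2"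
proof -
  show *: "cmod (\<alpha> n * B n) = cmod (\<alpha> n)" using norm_step[OF assms] by (simp add: norm_mult)
  have "1 - cmod (\<alpha> n * B n) \<le> cmod (1 - \<alpha> n * B n)" by (metis norm_one norm_triangle_ineq2)
  then show "cmod (1 - \<alpha> n * B n) \<ge> 1 / 2" using alpha_le_half[of n] * by linarith
qed

lemma x_nonzero: "x n \<noteq> 0"
proof (induction n)
  case 0
  then show ?case by (simp add: x_0)
next
  case (Suc n)
  have "v n \<noteq> 0" using Suc norm_v[of n] by auto
  moreover have "1 - \<alpha> n * B n \<noteq> 0" using norm_alpha_B[OF Suc] by force
  ultimately have "v (Suc n) \<noteq> 0" using norm_step[OF Suc] by simp
  then show ?case using norm_v[of "Suc n"] by auto
qed

lemmas norm_B = norm_step(1)[OF x_nonzero]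

text \<open>The phase moves by the disc automorphism \<open>B (Suc n) = z * (B n - cnj (\<alpha> n))
  / (1 - \<alpha> n * B n)\<close>, a perturbation of the rotation by \<open>z\<close>. The error
  has a numerator of modulus at most \<open>2 * cmod (\<alpha> n)\<close> and a denominator of
  modulus at least 1/2.\<close>

lemma B_Suc: "cmod (B (Suc n) - z * B n) \<le> 4 * cmod (\<alpha> n)"
proof -
  have v: "v n \<noteq> 0" using x_nonzero[of n] norm_v[of n] by auto
  define D where "D = 1 - \<alpha> n * B n"
  have D: "cmod D \<ge> 1 / 2" using norm_alpha_B[OF x_nonzero] by (simp add: D_def)
  then have "D \<noteq> 0" by auto
  have "B (Suc n) = z * (B n - cnj (\<alpha> n)) / D"
    unfolding B_def[of "Suc n"] norm_step[OF x_nonzero] using v by (simp add: D_def)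
  then have "B (Suc n) - z * B n = z * (\<alpha> n * B n * B n - cnj (\<alpha> n)) / D"
    using \<open>D \<noteq> 0\<close> by (simp add: field_simps) (simp add: D_def algebra_simps)
  then have "cmod (B (Suc n) - z * B n) = cmod (\<alpha> n * B n * B n - cnj (\<alpha> n)) / cmod D"
    by (simp add: norm_divide norm_mult z)
  also have "\<dots> \<le> (2 * cmod (\<alpha> n)) / (1 / 2)"
  proof (rule frac_le)
    show "cmod (\<alpha> n * B n * B n - cnj (\<alpha> n)) \<le> 2 * cmod (\<alpha> n)"
      using norm_triangle_ineq4[of "\<alpha> n * B n * B n" "cnj (\<alpha> n)"] by (simp add: norm_mult norm_B)
  qed (use D in auto)
  finally show ?thesis by simp
qed

text \<open>As \<open>v\<close> and \<open>x\<close> have equal modulus, \<open>cmod (x N)\<close>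
  is the product of the factors \<open>cmod (1 - \<alpha> n * B n)\<close>. Its logarithm is
  expanded to first order, and the quadratic errors are summable.\<close>

lemma neg_ln_norm_le:
  "- ln ((cmod (x N))\<^sup>2) \<le> (\<Sum>n<N. 2 * Re (\<alpha> n * B n)) + 25 * alpha_sq"
proof -
  have "- ln ((cmod (x N))\<^sup>2) \<le> (\<Sum>n<N. 2 * Re (\<alpha> n * B n) + 25 * (cmod (\<alpha> n))\<^sup>2)"
  proof (induction N)
    case 0
    then show ?case by (simp add: x_0)
  next
    case (Suc N)
    have nz: "cmod (1 - \<alpha> N * B N) > 0" using norm_alpha_B[OF x_nonzero, of N] by linarith
    have "cmod (x (Suc N)) = cmod (x N) * cmod (1 - \<alpha> N * B N)"
      using norm_step(2)[OF x_nonzero, of N] norm_v[of "Suc N"] norm_v[of N]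
      by (simp add: norm_mult)
    then have "(cmod (x (Suc N)))\<^sup>2 = (cmod (x N))\<^sup>2 * (cmod (1 - \<alpha> N * B N))\<^sup>2"
      by (simp only: power_mult_distrib)
    then have "- ln ((cmod (x (Suc N)))\<^sup>2) = - ln ((cmod (x N))\<^sup>2) - ln ((cmod (1 - \<alpha> N * B N))\<^sup>2)"
      using nz x_nonzero[of N] by (simp add: ln_mult)
    moreover have "- ln ((cmod (1 - \<alpha> N * B N))\<^sup>2) \<le> 2 * Re (\<alpha> N * B N) + 25 * (cmod (\<alpha> N * B N))\<^sup>2"
      by (rule neg_ln_one_minus_le) (use alpha_le_half[of N] norm_alpha_B(1)[OF x_nonzero, of N] in simp)
    ultimately show ?case
      using Suc unfolding sum.lessThan_Suc norm_alpha_B(1)[OF x_nonzero] by linarith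
  qed
  also have "\<dots> = (\<Sum>n<N. 2 * Re (\<alpha> n * B n)) + 25 * (\<Sum>n<N. (cmod (\<alpha> n))\<^sup>2)"
    by (simp add: sum.distrib sum_distrib_left)
  also have "\<dots> \<le> (\<Sum>n<N. 2 * Re (\<alpha> n * B n)) + 25 * alpha_sq"
    using sum_alpha_square_le[of "{..<N}"] by simp
  finally show ?thesis .
qed

lemma norm_lower_bound:
  obtains c where "c > 0" "\<And>N. N \<ge> 2 \<Longrightarrow> c / real N \<le> (cmod (x N))\<^sup>2"
proof
  define C where "C = 1 / 2 + 25 * alpha_sq"
  show "exp (- C) > 0" by simp
  fix N :: nat assume N: "N \<ge> 2"
  have "(\<Sum>n<N. 2 * Re (\<alpha> n * B n)) \<le> (\<Sum>n<N. 2 * ((real n + 1) * (cmod (\<alpha> n))\<^sup>2) + 1 / 2 * (1 / (real n + 1)))"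
  proof (rule sum_mono)
    fix n
    have "2 * Re (\<alpha> n * B n) \<le> 2 * cmod (\<alpha> n) * 1"
      using complex_Re_le_cmod[of "\<alpha> n * B n"] by (simp add: norm_alpha_B x_nonzero)
    \<comment> \<open>The weight \<open>2 * (n + 1)\<close> is optimal: a weight
      \<open>s * (n + 1)\<close> leads to \<open>(s/4 + 1/s) * ln N\<close>, with minimum 1 at
      \<open>s = 2\<close>. Exponent 1 is just small enough for \<open>c / N\<close> not to be
      summable.\<close>
    also have "\<dots> \<le> (2 * (real n + 1)) * (cmod (\<alpha> n))\<^sup>2 + 1\<^sup>2 / (2 * (real n + 1))"
      by (rule weighted_am_gm) simp
    also have "\<dots> = 2 * ((real n + 1) * (cmod (\<alpha> n))\<^sup>2) + 1 / 2 * (1 / (real n + 1))"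
      by (simp only: mult.assoc power_one divide_divide_eq_left times_divide_eq_right mult_1_right)
    finally show "2 * Re (\<alpha> n * B n) \<le> 2 * ((real n + 1) * (cmod (\<alpha> n))\<^sup>2) + 1 / 2 * (1 / (real n + 1))" .
  qed
  also have "\<dots> = 2 * (\<Sum>n<N. (real n + 1) * (cmod (\<alpha> n))\<^sup>2) + 1 / 2 * (\<Sum>n<N. 1 / (real n + 1))"
    unfolding sum.distrib sum_distrib_left ..
  also have "\<dots> \<le> 2 * (ln (real N) / 4) + 1 / 2 * (1 + ln (real N))"
    using N by (intro add_mono mult_left_mono weighted_sum_le harm_le_ln) auto
  finally have "- ln ((cmod (x N))\<^sup>2) \<le> C + ln (real N)"
    using neg_ln_norm_le[of N] unfolding C_def by argo
  then have "- C - ln (real N) \<le> ln ((cmod (x N))\<^sup>2)" by linarith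
  then have "exp (- C - ln (real N)) \<le> exp (ln ((cmod (x N))\<^sup>2))" by (simp only: exp_le_cancel_iff)
  then show "exp (- C) / real N \<le> (cmod (x N))\<^sup>2"
    using N x_nonzero[of N] by (simp add: exp_diff)
qed

end

section \<open>Oscillation of the relative phase of two orbits\<close>

lemma norm_diff_unit_mult_le:
  fixes a b c d :: "'a :: real_normed_algebra"
  assumes "norm a \<le> 1" "norm d \<le> 1"
  shows "norm (a * b - c * d) \<le> norm (a - c) + norm (b - d)"
proof -
  have "a * b - c * d = a * (b - d) + (a - c) * d" by (simp add: algebra_simps)
  then have "norm (a * b - c * d) \<le> norm (a * (b - d)) + norm ((a - c) * d)"
    by (simp add: norm_triangle_ineq)
  also have "\<dots> \<le> norm a * norm (b - d) + norm (a - c) * norm d"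
    by (intro add_mono norm_mult_ineq)
  also have "\<dots> \<le> 1 * norm (b - d) + norm (a - c) * 1"
    using assms by (intro add_mono mult_mono) auto
  finally show ?thesis by simp
qed

text \<open>Abel summation: a bounded sequence that is nearly geometric of ratio \<open>\<zeta> \<noteq> 1\<close> oscillates.\<close>

lemma bounded_harmonic_sum:
  fixes u :: "nat \<Rightarrow> complex"
  assumes u: "\<And>n. cmod (u n) \<le> 1"
    and step: "\<And>n. cmod (u (Suc n) - \<zeta> * u n) \<le> e n"
    and \<zeta>: "\<zeta> \<noteq> 1"
    and e: "\<And>N. (\<Sum>n<N. e n / (real n + 1)) \<le> E"
  shows "cmod (\<Sum>n<N. u n / (real n + 1)) \<le> (2 + E) / cmod (1 - \<zeta>)"
proof -
  define r where "r n = 1 / (real n + 1)" for n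
  have r_0: "r 0 = 1" by (simp add: r_def)
  \<comment> \<open>Summation by parts. As the weights decrease, the last sum is at most
    \<open>1 - r N\<close> in modulus, and with the boundary terms this gives the bound 2.\<close>
  have abel: "(\<Sum>n<N. (u n - u (Suc n)) * r n)
      = u 0 - u N * r N - (\<Sum>n<N. u (Suc n) * (r n - r (Suc n)))" for N
    by (induction N) (simp_all add: r_0 algebra_simps)
  have r_mono: "r (Suc n) \<le> r n" for n by (simp add: r_def frac_le)
  have r_le: "r n \<le> 1" for n by (simp add: r_def)
  have r_nn: "r n \<ge> 0" for n by (simp add: r_def)
  have "cmod (\<Sum>n<N. u (Suc n) * (r n - r (Suc n))) \<le> (\<Sum>n<N. r n - r (Suc n))"
  proof (rule sum_norm_le)
    fix n
    have "cmod (u (Suc n) * complex_of_real (r n - r (Suc n))) \<le> 1 * (r n - r (Suc n))"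
      unfolding norm_mult norm_of_real using u[of "Suc n"] r_mono[of n] by (intro mult_mono) auto
    then show "cmod (u (Suc n) * complex_of_real (r n - r (Suc n))) \<le> r n - r (Suc n)" by simp
  qed
  also have "\<dots> = 1 - r N" by (simp only: sum_lessThan_telescope' r_0)
  finally have 1: "cmod (\<Sum>n<N. u (Suc n) * (r n - r (Suc n))) \<le> 1 - r N" .
  have 2: "cmod (u N * r N) \<le> r N"
    using mult_right_mono[OF u[of N] r_nn[of N]] r_nn[of N] by (simp add: norm_mult)
  have 3: "cmod (\<Sum>n<N. (u n - u (Suc n)) * r n) \<le> 2"
    unfolding abel using 1 2 u[of 0]
      norm_triangle_ineq4[of "u 0 - u N * r N" "\<Sum>n<N. u (Suc n) * (r n - r (Suc n))"]
      norm_triangle_ineq4[of "u 0" "u N * r N"] by simp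
  have "cmod (\<Sum>n<N. (u (Suc n) - \<zeta> * u n) * r n) \<le> (\<Sum>n<N. e n / (real n + 1))"
  proof (rule sum_norm_le)
    fix n
    show "cmod ((u (Suc n) - \<zeta> * u n) * r n) \<le> e n / (real n + 1)"
      using mult_right_mono[OF step[of n] r_nn[of n]] r_nn[of n] by (simp add: norm_mult) (simp add: r_def)
  qed
  also have "\<dots> \<le> E" by (rule e)
  finally have 4: "cmod (\<Sum>n<N. (u (Suc n) - \<zeta> * u n) * r n) \<le> E" .
  \<comment> \<open>\<open>(1 - \<zeta>) * u n\<close> splits into the difference
    \<open>u n - u (Suc n)\<close>, treated by parts, and the error
    \<open>u (Suc n) - \<zeta> * u n\<close>.\<close>
  have "(1 - \<zeta>) * (\<Sum>n<N. u n / (real n + 1))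
      = (\<Sum>n<N. (u n - u (Suc n)) * r n) + (\<Sum>n<N. (u (Suc n) - \<zeta> * u n) * r n)"
    unfolding sum_distrib_left sum.distrib[symmetric]
    by (intro sum.cong) (auto simp: r_def diff_divide_distrib algebra_simps)
  then have "cmod (1 - \<zeta>) * cmod (\<Sum>n<N. u n / (real n + 1)) \<le> 2 + E"
    using 3 4 norm_triangle_ineq[of "\<Sum>n<N. (u n - u (Suc n)) * r n" "\<Sum>n<N. (u (Suc n) - \<zeta> * u n) * r n"]
    by (metis (no_types, lifting) add_mono norm_mult order_trans)
  then show ?thesis using \<zeta> by (simp add: field_simps)
qed

text \<open>Both orbits see the same \<open>\<alpha> n\<close>, so only the sum of their phases
  enters. Its squared modulus is \<open>2 + 2 * Re (u n)\<close>, where the relative phase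
  \<open>u\<close> nearly rotates by \<open>z * cnj z' \<noteq> 1\<close> and averages out. Treating
  the orbits separately, as in \<open>norm_lower_bound\<close>, would give the factor 2 in place of
  17/12.\<close>

lemma (in coulomb_decay) two_orbits_not_both_small:
  assumes "szego_orbit \<alpha> z x" "szego_orbit \<alpha> z' x'" "z \<noteq> z'"
  obtains C where "\<And>N. N \<ge> 2 \<Longrightarrow>
    - ln ((cmod (x N))\<^sup>2) - ln ((cmod (x' N))\<^sup>2) \<le> 17/12 * ln (real N) + C"
proof -
  interpret X: szego_orbit \<alpha> z x by fact
  interpret Y: szego_orbit \<alpha> z' x' by fact
  define u where "u n = X.B n * cnj (Y.B n)" for n
  define E where "E = 4 * (alpha_sq + 2)"
  define K where "K = (2 + E) / cmod (1 - z * cnj z')"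
  have err: "(\<Sum>n<N. 8 * cmod (\<alpha> n) / (real n + 1)) \<le> E" for N
  proof -
    have sq: "(\<Sum>n<N. 1 / (real n + 1)\<^sup>2) \<le> 2"
    proof -
      \<comment> \<open>At \<open>N = 0\<close> the right side is 2, since \<open>1 / 0 = 0\<close>;
        the step from 0 to 1 is therefore treated apart from the telescoping ones.\<close>
      have "(\<Sum>n<N. 1 / (real n + 1)\<^sup>2) \<le> 2 - 1 / real N"
      proof (induction N)
        case (Suc N)
        have "1 / (real N + 1)\<^sup>2 \<le> 1 / real N - 1 / (real N + 1)" if "N \<noteq> 0"
        proof -
          have "1 / (real N + 1)\<^sup>2 \<le> 1 / (real N * (real N + 1))"
            using that unfolding power2_eq_square by (intro divide_left_mono mult_right_mono) auto
          also have "\<dots> = 1 / real N - 1 / (real N + 1)" using that by (simp add: field_simps)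
          finally show ?thesis .
        qed
        then show ?case using Suc by (cases "N = 0") (auto simp: add.commute)
      qed simp
      also have "\<dots> \<le> 2" by simp
      finally show ?thesis .
    qed
    have "(\<Sum>n<N. 8 * cmod (\<alpha> n) / (real n + 1)) \<le> (\<Sum>n<N. 4 * (cmod (\<alpha> n))\<^sup>2 + 4 * (1 / (real n + 1)\<^sup>2))"
    proof (rule sum_mono)
      fix n
      show "8 * cmod (\<alpha> n) / (real n + 1) \<le> 4 * (cmod (\<alpha> n))\<^sup>2 + 4 * (1 / (real n + 1)\<^sup>2)"
        using weighted_am_gm[of 1 "cmod (\<alpha> n)" "1 / (real n + 1)"] by (simp add: power_divide)
    qed
    also have "\<dots> = 4 * (\<Sum>n<N. (cmod (\<alpha> n))\<^sup>2) + 4 * (\<Sum>n<N. 1 / (real n + 1)\<^sup>2)"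
      by (simp only: sum.distrib sum_distrib_left)
    also have "\<dots> \<le> E" unfolding E_def using sq sum_alpha_square_le[of "{..<N}"] by simp
    finally show ?thesis .
  qed
  have u_step: "cmod (u (Suc n) - z * cnj z' * u n) \<le> 8 * cmod (\<alpha> n)" for n
  proof -
    have "cmod (u (Suc n) - (z * X.B n) * cnj (z' * Y.B n))
        \<le> cmod (X.B (Suc n) - z * X.B n) + cmod (cnj (Y.B (Suc n)) - cnj (z' * Y.B n))"
      unfolding u_def by (rule norm_diff_unit_mult_le) (simp_all add: norm_mult X.norm_B Y.norm_B Y.z)
    also have "cmod (cnj (Y.B (Suc n)) - cnj (z' * Y.B n)) = cmod (Y.B (Suc n) - z' * Y.B n)"
      by (metis complex_cnj_diff complex_mod_cnj)
    finally show ?thesis using X.B_Suc[of n] Y.B_Suc[of n] by (simp add: u_def mult_ac)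
  qed
  have \<zeta>: "z * cnj z' \<noteq> 1"
  proof
    assume "z * cnj z' = 1"
    then have "z * (z' * cnj z') = z'" by (simp add: mult_ac)
    then show False using Y.z_cnj assms(3) by simp
  qed
  have osc: "cmod (\<Sum>n<N. u n / (real n + 1)) \<le> K" for N
    unfolding K_def
    by (rule bounded_harmonic_sum[OF _ u_step \<zeta> err]) (simp add: u_def norm_mult X.norm_B Y.norm_B)
  have "- ln ((cmod (x N))\<^sup>2) - ln ((cmod (x' N))\<^sup>2) \<le> 17/12 * ln (real N) + (2/3 + 2/3 * K + 50 * alpha_sq)"
    if N: "N \<ge> 2" for N
  proof -
    have sqn: "(cmod (X.B n + Y.B n))\<^sup>2 = 2 + 2 * Re (u n)" for n
    proof -
      have "(Re (X.B n))\<^sup>2 + (Im (X.B n))\<^sup>2 = 1" "(Re (Y.B n))\<^sup>2 + (Im (Y.B n))\<^sup>2 = 1"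
        using X.norm_B[of n] Y.norm_B[of n] by (simp_all flip: cmod_power2)
      then show ?thesis unfolding cmod_power2 u_def by (simp add: power2_eq_square algebra_simps)
    qed
    have "(\<Sum>n<N. 2 * Re (\<alpha> n * X.B n)) + (\<Sum>n<N. 2 * Re (\<alpha> n * Y.B n))
        = (\<Sum>n<N. 2 * Re (\<alpha> n * (X.B n + Y.B n)))"
      by (simp add: sum.distrib[symmetric] algebra_simps)
    also have "\<dots> \<le> (\<Sum>n<N. 3 * ((real n + 1) * (cmod (\<alpha> n))\<^sup>2)
        + (2/3 * (1 / (real n + 1)) + 2/3 * Re (u n / (real n + 1))))"
    proof (rule sum_mono)
      fix n
      have "2 * Re (\<alpha> n * (X.B n + Y.B n)) \<le> 2 * cmod (\<alpha> n) * cmod (X.B n + Y.B n)"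
        using complex_Re_le_cmod[of "\<alpha> n * (X.B n + Y.B n)"] by (simp add: norm_mult)
      \<comment> \<open>A weight \<open>s * (n + 1)\<close> leads to
        \<open>(s/4 + 2/s) * ln N\<close>, which is below \<open>3/2 * ln N\<close> exactly for
        \<open>2 < s < 4\<close>. The choice \<open>s = 3\<close> gives 3/4 + 2/3 = 17/12.\<close>
      also have "\<dots> \<le> (3 * (real n + 1)) * (cmod (\<alpha> n))\<^sup>2 + (cmod (X.B n + Y.B n))\<^sup>2 / (3 * (real n + 1))"
        by (rule weighted_am_gm) simp
      also have "(cmod (X.B n + Y.B n))\<^sup>2 / (3 * (real n + 1)) = 2/3 * (1 / (real n + 1)) + 2/3 * (Re (u n) / (real n + 1))"
        unfolding sqn by (simp only: add_divide_distrib) simp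
      also have "Re (u n) / (real n + 1) = Re (u n / (real n + 1))"
        by (metis Re_divide_of_real of_real_1 of_real_add of_real_of_nat_eq)
      finally show "2 * Re (\<alpha> n * (X.B n + Y.B n)) \<le> 3 * ((real n + 1) * (cmod (\<alpha> n))\<^sup>2)
        + (2/3 * (1 / (real n + 1)) + 2/3 * Re (u n / (real n + 1)))" by (simp only: mult.assoc)
    qed
    also have "\<dots> = 3 * (\<Sum>n<N. (real n + 1) * (cmod (\<alpha> n))\<^sup>2)
        + (2/3 * (\<Sum>n<N. 1 / (real n + 1)) + 2/3 * Re (\<Sum>n<N. u n / (real n + 1)))"
      unfolding sum.distrib sum_distrib_left Re_sum ..
    also have "\<dots> \<le> 3 * (ln (real N) / 4) + (2/3 * (1 + ln (real N)) + 2/3 * K)"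
      using N osc[of N] complex_Re_le_cmod[of "\<Sum>n<N. u n / (real n + 1)"]
      by (intro add_mono mult_left_mono weighted_sum_le harm_le_ln) auto
    finally show ?thesis
      using X.neg_ln_norm_le[of N] Y.neg_ln_norm_le[of N] by argo
  qed
  then show ?thesis by (rule that)
qed

section \<open>Orthogonality on the circle\<close>

locale szego_polys = prob_space M for M :: "complex measure" +
  fixes \<Phi> :: "nat \<Rightarrow> complex poly" and \<alpha> :: "nat \<Rightarrow> complex"
  assumes sets_M: "sets M = sets circle_borel"
    and monic_orthogonal: "monic_orthogonal_polys M \<Phi>"
    and szego: "z \<noteq> 0 \<Longrightarrow>
      poly (\<Phi> (Suc n)) z = z * poly (\<Phi> n) z - cnj (\<alpha> n) * szego_reversed n (\<Phi> n) z"
begin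

text \<open>On the unit circle \<open>v n\<close> agrees with the reversed polynomial \<open>\<Phi>\<^sub>n\<^sup>*\<close>.\<close>

definition \<phi> where "\<phi> n z = poly (\<Phi> n) z"
definition v where "v n z = z^n * cnj (\<phi> n z)"
definition c where "c n = (\<integral>z. (cmod (\<phi> n z))\<^sup>2 \<partial>M)"

lemma space_M: "space M = sphere 0 1"
  using sets_eq_imp_space_eq[OF sets_M] by (simp add: circle_borel_def space_restrict_space)

lemma continuous_integrable:
  fixes f :: "complex \<Rightarrow> 'b :: {banach, second_countable_topology}"
  assumes "continuous_on (sphere 0 1) f"
  shows "integrable M f"
proof -
  have "bounded (f ` sphere 0 1)"
    by (intro compact_imp_bounded compact_continuous_image assms) simp
  then obtain b where b: "\<And>z. z \<in> sphere 0 1 \<Longrightarrow> norm (f z) \<le> b"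
    unfolding bounded_iff by (metis imageI)
  have meas: "f \<in> borel_measurable M"
    using borel_measurable_continuous_on_restrict[OF assms]
    unfolding measurable_cong_sets[OF sets_M refl] circle_borel_def .
  show ?thesis
    by (rule integrable_const_bound[OF AE_I2 meas]) (use b space_M in auto)
qed

lemma continuous_on_\<phi> [continuous_intros]: "continuous_on A f \<Longrightarrow> continuous_on A (\<lambda>z. \<phi> n (f z))"
  unfolding \<phi>_def by (intro continuous_intros)

lemma continuous_on_v [continuous_intros]: "continuous_on A f \<Longrightarrow> continuous_on A (\<lambda>z. v n (f z))"
  unfolding v_def by (intro continuous_intros)

lemma circle_cnj: "z \<in> sphere 0 1 \<Longrightarrow> z * cnj z = 1"
  using complex_norm_square[of z] by simp

lemma norm_v: "z \<in> sphere 0 1 \<Longrightarrow> cmod (v n z) = cmod (\<phi> n z)"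
  by (simp add: v_def norm_mult norm_power)

lemma degree_\<Phi>: "degree (\<Phi> n) = n" and lead_coeff_\<Phi>: "coeff (\<Phi> n) n = 1"
  using monic_orthogonal unfolding monic_orthogonal_polys_def by metis+

lemma \<phi>_0: "\<phi> 0 z = 1"
proof -
  obtain a where "\<Phi> 0 = [:a:]" using degree_\<Phi>[of 0] by (rule degree_eq_zeroE)
  then show ?thesis using lead_coeff_\<Phi>[of 0] by (simp add: \<phi>_def)
qed

lemma \<phi>_Suc:
  assumes "z \<in> sphere 0 1"
  shows "\<phi> (Suc n) z = z * \<phi> n z - cnj (\<alpha> n) * v n z"
proof -
  have "z \<noteq> 0" using assms by auto
  moreover have "1 / cnj z = z" using circle_cnj[OF assms] \<open>z \<noteq> 0\<close> by (simp add: field_simps)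
  ultimately show ?thesis
    using szego[of z n] by (simp add: \<phi>_def v_def szego_reversed_def)
qed

lemma v_Suc:
  assumes "z \<in> sphere 0 1"
  shows "v (Suc n) z = v n z - \<alpha> n * z * \<phi> n z"
proof -
  have "v (Suc n) z = (z * cnj z) * v n z - \<alpha> n * z * (z * cnj z)^n * \<phi> n z"
    unfolding power_mult_distrib by (simp add: v_def \<phi>_Suc[OF assms] algebra_simps)
  then show ?thesis by (simp only: circle_cnj[OF assms] power_one mult_1_left mult_1_right)
qed

lemma v_diff:
  assumes "z \<in> sphere 0 1"
  shows "v m z - v (m + k) z = z * (\<Sum>n\<in>{m..<m+k}. \<alpha> n * \<phi> n z)"
proof (induction k)
  case (Suc k)
  then show ?case using v_Suc[OF assms, of "m + k"] by (simp add: algebra_simps)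
qed simp

lemma orthogonal: "m \<noteq> n \<Longrightarrow> (\<integral>z. \<phi> m z * cnj (\<phi> n z) \<partial>M) = 0"
  using monic_orthogonal by (auto simp: monic_orthogonal_polys_def \<phi>_def)

text \<open>Subtracting \<open>coeff P m\<close> times the monic \<open>\<Phi> m\<close> removes the
  top coefficient and, by orthogonality, leaves the integral unchanged. Bounding the support of the
  coefficients rather than the degree makes \<open>m = 0\<close> the case of the zero
  polynomial.\<close>

lemma orthogonal_lower_degree:
  assumes "m \<le> n" "\<And>i. i \<ge> m \<Longrightarrow> coeff P i = 0"
  shows "(\<integral>z. poly P z * cnj (\<phi> n z) \<partial>M) = 0"
  using assms
proof (induction m arbitrary: P)
  case 0
  then have "P = 0" by (intro poly_eqI) simp
  then show ?case by simp
next
  case (Suc m)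
  define Q where "Q = P - smult (coeff P m) (\<Phi> m)"
  have "coeff Q i = 0" if "i \<ge> m" for i
    using that degree_\<Phi>[of m] lead_coeff_\<Phi>[of m] Suc.prems(2)[of i] coeff_eq_0[of "\<Phi> m" i]
    by (cases "i = m") (auto simp: Q_def)
  then have Q: "(\<integral>z. poly Q z * cnj (\<phi> n z) \<partial>M) = 0"
    using Suc by simp
  have "(\<integral>z. poly P z * cnj (\<phi> n z) \<partial>M)
      = (\<integral>z. poly Q z * cnj (\<phi> n z) + coeff P m * (\<phi> m z * cnj (\<phi> n z)) \<partial>M)"
    by (simp add: Q_def \<phi>_def algebra_simps)
  also have "\<dots> = 0"
    using Suc.prems(1)
    by (subst Bochner_Integration.integral_add)
       (auto intro!: continuous_integrable continuous_intros simp: Q orthogonal)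
  finally show ?case .
qed

text \<open>The conjugate in \<open>v\<close> hides that it is a polynomial in \<open>z\<close> on
  the circle; the recursion exhibits it as one. This makes \<open>v n\<close> orthogonal to the next
  orthogonal polynomial.\<close>

lemma v_poly: "\<exists>P. degree P \<le> n \<and> (\<forall>z\<in>sphere 0 1. poly P z = v n z)"
proof (induction n)
  case 0
  show ?case by (rule exI[of _ 1]) (simp add: v_def \<phi>_0)
next
  case (Suc n)
  then obtain P where P: "degree P \<le> n" "\<And>z. z \<in> sphere 0 1 \<Longrightarrow> poly P z = v n z" by blast
  have "degree (smult (\<alpha> n) (pCons 0 (\<Phi> n))) \<le> Suc n"
    using degree_smult_le[of "\<alpha> n" "pCons 0 (\<Phi> n)"] degree_pCons_le[of 0 "\<Phi> n"] degree_\<Phi>[of n]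
    by linarith
  then have "degree (P - smult (\<alpha> n) (pCons 0 (\<Phi> n))) \<le> Suc n"
    using P(1) by (intro degree_diff_le) auto
  moreover have "\<forall>z\<in>sphere 0 1. poly (P - smult (\<alpha> n) (pCons 0 (\<Phi> n))) z = v (Suc n) z"
    using P(2) by (simp add: v_Suc \<phi>_def)
  ultimately show ?case by blast
qed

lemma v_orthogonal: "(\<integral>z. v n z * cnj (\<phi> (Suc n) z) \<partial>M) = 0"
proof -
  obtain P where P: "degree P \<le> n" "\<And>z. z \<in> sphere 0 1 \<Longrightarrow> poly P z = v n z"
    using v_poly by blast
  have "(\<integral>z. v n z * cnj (\<phi> (Suc n) z) \<partial>M) = (\<integral>z. poly P z * cnj (\<phi> (Suc n) z) \<partial>M)"
    by (rule Bochner_Integration.integral_cong) (auto simp: P space_M)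
  also have "\<dots> = 0"
    by (rule orthogonal_lower_degree[OF order_refl]) (use P(1) in \<open>auto intro: coeff_eq_0\<close>)
  finally show ?thesis .
qed

text \<open>Pythagoras for the recursion solved for \<open>z * \<phi> n z\<close>: the summands
  \<open>\<phi> (Suc n) z\<close> and \<open>cnj (\<alpha> n) * v n z\<close> are orthogonal, and
  \<open>z\<close> has modulus 1 on the circle.\<close>

lemma c_Suc: "c n = c (Suc n) + (cmod (\<alpha> n))\<^sup>2 * c n"
proof -
  have eq: "(cmod (\<phi> n z))\<^sup>2 = (cmod (\<phi> (Suc n) z))\<^sup>2 + (cmod (\<alpha> n))\<^sup>2 * (cmod (\<phi> n z))\<^sup>2
      + 2 * Re (cnj (\<alpha> n) * (v n z * cnj (\<phi> (Suc n) z)))" if "z \<in> sphere 0 1" for z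
  proof -
    have "(cmod (\<phi> n z))\<^sup>2 = (cmod (\<phi> (Suc n) z + cnj (\<alpha> n) * v n z))\<^sup>2"
      using that by (simp add: \<phi>_Suc norm_mult)
    also have "\<dots> = (cmod (\<phi> (Suc n) z))\<^sup>2 + (cmod (cnj (\<alpha> n) * v n z))\<^sup>2
        + 2 * Re ((cnj (\<alpha> n) * v n z) * cnj (\<phi> (Suc n) z))"
      unfolding cmod_power2 by (simp add: power2_eq_square algebra_simps)
    finally show ?thesis by (simp only: norm_mult power_mult_distrib norm_v[OF that] complex_mod_cnj mult.assoc)
  qed
  have int: "integrable M (\<lambda>z. cnj (\<alpha> n) * (v n z * cnj (\<phi> (Suc n) z)))"
    by (intro continuous_integrable continuous_intros)
  have "c n = (\<integral>z. ((cmod (\<phi> (Suc n) z))\<^sup>2 + (cmod (\<alpha> n))\<^sup>2 * (cmod (\<phi> n z))\<^sup>2)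
      + 2 * Re (cnj (\<alpha> n) * (v n z * cnj (\<phi> (Suc n) z))) \<partial>M)"
    unfolding c_def by (rule Bochner_Integration.integral_cong[OF refl]) (use eq space_M in blast)
  also have "\<dots> = (\<integral>z. (cmod (\<phi> (Suc n) z))\<^sup>2 + (cmod (\<alpha> n))\<^sup>2 * (cmod (\<phi> n z))\<^sup>2 \<partial>M)
      + (\<integral>z. 2 * Re (cnj (\<alpha> n) * (v n z * cnj (\<phi> (Suc n) z))) \<partial>M)"
    by (intro Bochner_Integration.integral_add continuous_integrable continuous_intros)
  also have "(\<integral>z. (cmod (\<phi> (Suc n) z))\<^sup>2 + (cmod (\<alpha> n))\<^sup>2 * (cmod (\<phi> n z))\<^sup>2 \<partial>M)
      = (\<integral>z. (cmod (\<phi> (Suc n) z))\<^sup>2 \<partial>M) + (\<integral>z. (cmod (\<alpha> n))\<^sup>2 * (cmod (\<phi> n z))\<^sup>2 \<partial>M)"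
    by (intro Bochner_Integration.integral_add continuous_integrable continuous_intros)
  also have "(\<integral>z. 2 * Re (cnj (\<alpha> n) * (v n z * cnj (\<phi> (Suc n) z))) \<partial>M) = 0"
    using integral_Re[OF int] by (simp only: integral_mult_right_zero v_orthogonal) simp
  finally show ?thesis by (simp add: c_def)
qed

lemma c_nonneg: "c n \<ge> 0"
  by (simp add: c_def)

lemma c_le_1: "c n \<le> 1"
proof (induction n)
  case 0
  show ?case by (simp add: c_def \<phi>_0 prob_space)
next
  case (Suc n)
  have "(cmod (\<alpha> n))\<^sup>2 * c n \<ge> 0" using c_nonneg by simp
  then show ?case using Suc c_Suc[of n] by linarith
qed

lemma parseval:
  assumes "finite I"
  shows "(\<integral>z. (cmod (\<Sum>n\<in>I. a n * \<phi> n z))\<^sup>2 \<partial>M) = (\<Sum>n\<in>I. (cmod (a n))\<^sup>2 * c n)"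
proof -
  have "complex_of_real (\<integral>z. (cmod (\<Sum>n\<in>I. a n * \<phi> n z))\<^sup>2 \<partial>M)
      = (\<integral>z. complex_of_real ((cmod (\<Sum>n\<in>I. a n * \<phi> n z))\<^sup>2) \<partial>M)"
    by (simp only: integral_complex_of_real)
  also have "\<dots> = (\<integral>z. (\<Sum>m\<in>I. \<Sum>n\<in>I. (a m * cnj (a n)) * (\<phi> m z * cnj (\<phi> n z))) \<partial>M)"
    by (simp only: complex_norm_square cnj_sum sum_product complex_cnj_mult mult_ac)
  also have "\<dots> = (\<Sum>m\<in>I. \<integral>z. (\<Sum>n\<in>I. (a m * cnj (a n)) * (\<phi> m z * cnj (\<phi> n z))) \<partial>M)"
    by (intro Bochner_Integration.integral_sum continuous_integrable continuous_intros)
  also have "\<dots> = (\<Sum>m\<in>I. \<Sum>n\<in>I. \<integral>z. (a m * cnj (a n)) * (\<phi> m z * cnj (\<phi> n z)) \<partial>M)"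
    by (intro sum.cong refl Bochner_Integration.integral_sum continuous_integrable continuous_intros)
  also have "\<dots> = (\<Sum>m\<in>I. \<Sum>n\<in>I. if n = m then complex_of_real ((cmod (a m))\<^sup>2 * c m) else 0)"
  proof (intro sum.cong refl)
    fix m n
    have "(\<integral>z. \<phi> m z * cnj (\<phi> m z) \<partial>M) = complex_of_real (c m)"
      by (simp only: c_def complex_norm_square[symmetric] integral_complex_of_real)
    then show "(\<integral>z. (a m * cnj (a n)) * (\<phi> m z * cnj (\<phi> n z)) \<partial>M)
        = (if n = m then complex_of_real ((cmod (a m))\<^sup>2 * c m) else 0)"
      using orthogonal[of m n] by (auto simp: integral_mult_right_zero simp flip: complex_norm_square)
  qed
  also have "\<dots> = complex_of_real (\<Sum>m\<in>I. (cmod (a m))\<^sup>2 * c m)"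
    using assms by simp
  finally show ?thesis by (simp only: of_real_eq_iff)
qed

text \<open>By \<open>v_diff\<close> the difference is \<open>z\<close> times an orthogonal sum with
  coefficients \<open>\<alpha> n\<close>, and the squared norms \<open>c n\<close> are at most
  1.\<close>

lemma v_diff_norm_le:
  "(\<integral>z. (cmod (v m z - v (m + k) z))\<^sup>2 \<partial>M) \<le> (\<Sum>n\<in>{m..<m+k}. (cmod (\<alpha> n))\<^sup>2)"
proof -
  have "(\<integral>z. (cmod (v m z - v (m + k) z))\<^sup>2 \<partial>M) = (\<integral>z. (cmod (\<Sum>n\<in>{m..<m+k}. \<alpha> n * \<phi> n z))\<^sup>2 \<partial>M)"
    by (rule Bochner_Integration.integral_cong) (auto simp: v_diff norm_mult space_M)
  also have "\<dots> = (\<Sum>n\<in>{m..<m+k}. (cmod (\<alpha> n))\<^sup>2 * c n)"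
    by (rule parseval) simp
  also have "\<dots> \<le> (\<Sum>n\<in>{m..<m+k}. (cmod (\<alpha> n))\<^sup>2 * 1)"
    by (intro sum_mono mult_left_mono c_le_1) simp
  finally show ?thesis by simp
qed

text \<open>On the circle \<open>z\<^sup>k \<Phi>\<^sub>m\<^sup>* \<close> times the conjugate of \<open>\<Phi>\<^sub>m\<^sub>+\<^sub>k\<^sup>*\<close> is \<open>\<Phi>\<^sub>m\<^sub>+\<^sub>k\<close> times the conjugate
  of \<open>\<Phi>\<^sub>m\<close>, which has mean zero; only the difference of the reversed polynomials contributes.\<close>

lemma moment_le:
  assumes "k \<ge> 1"
  shows "cmod (\<integral>z. z^k * (cmod (\<phi> m z))\<^sup>2 \<partial>M) \<le> (\<Sum>n\<in>{m..<m+k}. cmod (\<alpha> n))"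
proof -
  have eq: "z^k * complex_of_real ((cmod (\<phi> m z))\<^sup>2)
      = z^k * v m z * cnj (v m z - v (m + k) z) + \<phi> (m + k) z * cnj (\<phi> m z)"
    if z: "z \<in> sphere 0 1" for z
  proof -
    have "z^k * v m z * cnj (v (m + k) z) = (z * cnj z)^(m+k) * (\<phi> (m + k) z * cnj (\<phi> m z))"
      unfolding v_def power_mult_distrib by (simp add: power_add mult_ac)
    also have "\<dots> = \<phi> (m + k) z * cnj (\<phi> m z)"
      by (simp only: circle_cnj[OF z] power_one mult_1_left)
    finally have 1: "z^k * v m z * cnj (v (m + k) z) = \<phi> (m + k) z * cnj (\<phi> m z)" .
    have "complex_of_real ((cmod (\<phi> m z))\<^sup>2) = v m z * cnj (v m z)"
      by (simp only: norm_v[OF z, symmetric] complex_norm_square)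
    then show ?thesis unfolding 1[symmetric] by (simp add: algebra_simps)
  qed
  have "(\<integral>z. z^k * complex_of_real ((cmod (\<phi> m z))\<^sup>2) \<partial>M)
      = (\<integral>z. z^k * v m z * cnj (v m z - v (m + k) z) + \<phi> (m + k) z * cnj (\<phi> m z) \<partial>M)"
    by (rule Bochner_Integration.integral_cong[OF refl]) (use eq space_M in blast)
  also have "\<dots> = (\<integral>z. z^k * v m z * cnj (v m z - v (m + k) z) \<partial>M) + (\<integral>z. \<phi> (m + k) z * cnj (\<phi> m z) \<partial>M)"
    by (intro Bochner_Integration.integral_add continuous_integrable continuous_intros)
  also have "\<dots> = (\<integral>z. z^k * v m z * cnj (v m z - v (m + k) z) \<partial>M)"
    using assms by (simp add: orthogonal)
  \<comment> \<open>The pointwise bound \<open>2 * a * b \<le> a^2 + b^2\<close> plays the role of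
    Cauchy-Schwarz, so that only \<open>c m\<close> and \<open>c n\<close> appear after
    integration.\<close>
  also have "cmod \<dots> \<le> (\<integral>z. (\<Sum>n\<in>{m..<m+k}. cmod (\<alpha> n) * (((cmod (\<phi> m z))\<^sup>2 + (cmod (\<phi> n z))\<^sup>2) / 2)) \<partial>M)"
  proof (rule Bochner_Integration.integral_norm_bound_integral)
    fix z assume "z \<in> space M"
    then have z: "z \<in> sphere 0 1" by (simp add: space_M)
    have "cmod (z^k * v m z * cnj (v m z - v (m + k) z))
        = cmod (\<phi> m z) * cmod (\<Sum>n\<in>{m..<m+k}. \<alpha> n * \<phi> n z)"
      using z by (simp only: norm_mult complex_mod_cnj v_diff norm_v) (simp add: norm_power)
    also have "\<dots> \<le> cmod (\<phi> m z) * (\<Sum>n\<in>{m..<m+k}. cmod (\<alpha> n) * cmod (\<phi> n z))"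
      by (intro mult_left_mono sum_norm_le) (auto simp: norm_mult)
    also have "\<dots> \<le> (\<Sum>n\<in>{m..<m+k}. cmod (\<alpha> n) * (((cmod (\<phi> m z))\<^sup>2 + (cmod (\<phi> n z))\<^sup>2) / 2))"
      unfolding sum_distrib_left
    proof (rule sum_mono)
      fix n
      have "2 * cmod (\<phi> m z) * cmod (\<phi> n z) \<le> (cmod (\<phi> m z))\<^sup>2 + (cmod (\<phi> n z))\<^sup>2"
        by (rule sum_squares_bound)
      then have "cmod (\<alpha> n) * (cmod (\<phi> m z) * cmod (\<phi> n z))
          \<le> cmod (\<alpha> n) * (((cmod (\<phi> m z))\<^sup>2 + (cmod (\<phi> n z))\<^sup>2) / 2)"
        by (intro mult_left_mono) auto
      then show "cmod (\<phi> m z) * (cmod (\<alpha> n) * cmod (\<phi> n z))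
          \<le> cmod (\<alpha> n) * (((cmod (\<phi> m z))\<^sup>2 + (cmod (\<phi> n z))\<^sup>2) / 2)"
        by (simp only: mult_ac)
    qed
    finally show "cmod (z^k * v m z * cnj (v m z - v (m + k) z))
        \<le> (\<Sum>n\<in>{m..<m+k}. cmod (\<alpha> n) * (((cmod (\<phi> m z))\<^sup>2 + (cmod (\<phi> n z))\<^sup>2) / 2))" .
  qed (intro continuous_integrable continuous_intros; simp)+
  also have "\<dots> = (\<Sum>n\<in>{m..<m+k}. \<integral>z. cmod (\<alpha> n) * (((cmod (\<phi> m z))\<^sup>2 + (cmod (\<phi> n z))\<^sup>2) / 2) \<partial>M)"
    by (intro Bochner_Integration.integral_sum continuous_integrable continuous_intros) simp
  also have "\<dots> = (\<Sum>n\<in>{m..<m+k}. cmod (\<alpha> n) * ((c m + c n) / 2))"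
  proof (intro sum.cong refl)
    fix n
    have "(\<integral>z. (cmod (\<phi> m z))\<^sup>2 + (cmod (\<phi> n z))\<^sup>2 \<partial>M) = c m + c n"
      unfolding c_def by (intro Bochner_Integration.integral_add continuous_integrable continuous_intros)
    then show "(\<integral>z. cmod (\<alpha> n) * (((cmod (\<phi> m z))\<^sup>2 + (cmod (\<phi> n z))\<^sup>2) / 2) \<partial>M) = cmod (\<alpha> n) * ((c m + c n) / 2)"
      by simp
  qed
  also have "\<dots> \<le> (\<Sum>n\<in>{m..<m+k}. cmod (\<alpha> n) * 1)"
  proof (intro sum_mono mult_left_mono)
    fix n show "(c m + c n) / 2 \<le> 1" using c_le_1[of m] c_le_1[of n] by simp
  qed simp
  finally show ?thesis by simp
qed

text \<open>A Christoffel function estimate. The test polynomial with coefficients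
  \<open>cnj (\<phi> n w)\<close> takes at \<open>w\<close> the value \<open>X\<close> of the sum;
  its squared norm is at most \<open>X\<close>, and at least \<open>X^2\<close> times the mass of
  the point.\<close>

lemma atom_bound: "(\<Sum>n\<in>{..<N}. (cmod (\<phi> n w))\<^sup>2) * measure M {w} \<le> 1"
proof (cases "w \<in> sphere 0 1")
  case False
  \<comment> \<open>Off the circle \<open>{w}\<close> is not measurable for \<open>M\<close>, and
    \<open>measure\<close> is 0 there by convention.\<close>
  then have "measure M {w} = 0" by (intro measure_notin_sets) (use sets.sets_into_space space_M in blast)
  then show ?thesis by simp
next
  case True
  define X where "X = (\<Sum>n\<in>{..<N}. (cmod (\<phi> n w))\<^sup>2)"
  define f where "f z = (cmod (\<Sum>n\<in>{..<N}. cnj (\<phi> n w) * \<phi> n z))\<^sup>2" for z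
  have w: "{w} \<in> sets M"
  proof -
    have "{w} \<in> sets borel" by simp
    then show ?thesis using True by (simp add: sets_M circle_borel_def sets_restrict_space_iff)
  qed
  have "(\<Sum>n\<in>{..<N}. cnj (\<phi> n w) * \<phi> n w) = complex_of_real X"
    by (simp only: X_def of_real_sum complex_norm_square mult.commute)
  then have fw: "f w = X\<^sup>2" by (simp add: f_def)
  have "X\<^sup>2 * measure M {w} = (\<integral>z. indicator {w} z * X\<^sup>2 \<partial>M)"
    using w by simp
  also have "\<dots> \<le> (\<integral>z. f z \<partial>M)"
  proof (rule integral_mono)
    show "integrable M f" unfolding f_def by (intro continuous_integrable continuous_intros)
    show "integrable M (\<lambda>z. indicator {w} z * X\<^sup>2)"
      using w by (intro integrable_mult_left integrable_real_indicator) (auto simp: less_top[symmetric])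
    show "indicator {w} z * X\<^sup>2 \<le> f z" for z
      by (auto simp: indicator_def fw) (simp add: f_def)
  qed
  also have "\<dots> = (\<Sum>n\<in>{..<N}. (cmod (\<phi> n w))\<^sup>2 * c n)"
    unfolding f_def by (subst parseval) simp_all
  also have "\<dots> \<le> (\<Sum>n\<in>{..<N}. (cmod (\<phi> n w))\<^sup>2 * 1)"
    by (intro sum_mono mult_left_mono c_le_1) simp
  also have "\<dots> = X" by (simp add: X_def)
  finally have "X * (X * measure M {w}) \<le> X * 1" by (simp add: power2_eq_square)
  moreover have "X \<ge> 0" by (simp add: X_def sum_nonneg)
  ultimately show ?thesis
    unfolding X_def[symmetric] by (cases "X = 0") (simp_all add: mult_le_cancel_left)
qed

end

section \<open>Comparison with Lebesgue measure\<close>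

lemma space_circle_lebesgue: "space circle_lebesgue = sphere 0 1"
  by (simp add: circle_lebesgue_def circle_borel_def space_restrict_space)

lemma sets_circle_lebesgue: "sets circle_lebesgue = sets circle_borel"
  by (simp add: circle_lebesgue_def)

lemma emeasure_circle_lebesgue_space: "emeasure circle_lebesgue (space circle_lebesgue) = ennreal (2 * pi)"
proof -
  have "emeasure circle_lebesgue (space circle_lebesgue)
      = emeasure (restrict_space lborel {0..<2*pi}) {0..<2*pi}"
    unfolding circle_lebesgue_def space_distr
    by (subst emeasure_distr[OF measurable_cis_circle])
       (auto simp: circle_borel_def space_restrict_space sets_restrict_space_iff intro!: arg_cong[where f = "emeasure _"])
  also have "\<dots> = ennreal (2 * pi)"
    by (subst emeasure_restrict_space) auto
  finally show ?thesis .
qed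

lemma finite_measure_circle_lebesgue: "finite_measure circle_lebesgue"
  by (rule finite_measureI) (simp add: emeasure_circle_lebesgue_space)

lemma measure_circle_lebesgue_space: "measure circle_lebesgue (sphere 0 1) = 2 * pi"
  using emeasure_circle_lebesgue_space by (simp add: measure_def space_circle_lebesgue)

text \<open>\<open>cis\<close> is injective on the half-open period, so the preimage is finite. The
  intersection with the circle keeps the set measurable for every \<open>z\<close>; countable unions
  of such sets later carry the pure point part.\<close>

lemma circle_lebesgue_singleton: "{z} \<inter> sphere 0 1 \<in> null_sets circle_lebesgue"
proof (rule null_setsI)
  have s: "{z} \<inter> sphere 0 1 \<in> sets circle_borel"
    by (simp add: circle_borel_def sets_restrict_space_iff)
  then show "{z} \<inter> sphere 0 1 \<in> sets circle_lebesgue" by (simp add: sets_circle_lebesgue)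
  let ?A = "cis -` ({z} \<inter> sphere 0 1) \<inter> {0..<2*pi}"
  have "finite (cis -` {z} \<inter> {0..<2*pi})"
  proof (rule finite_vimage_IntI)
    show "inj_on cis {0..<2*pi}"
    proof (rule inj_onI)
      fix x y :: real assume xy: "x \<in> {0..<2*pi}" "y \<in> {0..<2*pi}" "cis x = cis y"
      have "sin x = sin y \<and> cos x = cos y" using arg_cong[OF xy(3), of Re] arg_cong[OF xy(3), of Im] by simp
      then obtain n :: int where n: "x = y + 2 * pi * n"
        using sin_cos_eq_iff[of x y] by blast
      have "\<bar>x - y\<bar> < 2 * pi" using xy(1,2) unfolding atLeastLessThan_iff by linarith
      moreover have "\<bar>x - y\<bar> = 2 * pi * \<bar>real_of_int n\<bar>"
        unfolding n add_diff_cancel_left' abs_mult by simp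
      ultimately have "2 * pi * \<bar>real_of_int n\<bar> < 2 * pi * 1" by linarith
      then have "\<bar>real_of_int n\<bar> < 1" by (rule mult_left_less_imp_less) simp
      then have "n = 0" by linarith
      then show "x = y" using n by simp
    qed
  qed simp
  then have "finite ?A" by (rule finite_subset[rotated]) blast
  then have "emeasure lborel ?A = 0"
    by (intro emeasure_lborel_countable countable_finite)
  moreover have "emeasure circle_lebesgue ({z} \<inter> sphere 0 1) = emeasure (restrict_space lborel {0..<2*pi}) ?A"
    unfolding circle_lebesgue_def emeasure_distr[OF measurable_cis_circle s]
    by (simp add: space_restrict_space)
  moreover have "\<dots> = emeasure lborel ?A"
    by (rule emeasure_restrict_space) auto
  ultimately show "emeasure circle_lebesgue ({z} \<inter> sphere 0 1) = 0"
    by simp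
qed

lemma circle_lebesgue_integrable:
  fixes f :: "complex \<Rightarrow> 'b :: {banach, second_countable_topology}"
  assumes "continuous_on (sphere 0 1) f"
  shows "integrable circle_lebesgue f"
proof -
  interpret finite_measure circle_lebesgue by (rule finite_measure_circle_lebesgue)
  have "bounded (f ` sphere 0 1)"
    by (intro compact_imp_bounded compact_continuous_image assms) simp
  then obtain b where b: "\<And>z. z \<in> sphere 0 1 \<Longrightarrow> norm (f z) \<le> b"
    unfolding bounded_iff by (metis imageI)
  have meas: "f \<in> borel_measurable circle_lebesgue"
    using borel_measurable_continuous_on_restrict[OF assms]
    unfolding measurable_cong_sets[OF sets_circle_lebesgue refl] circle_borel_def .
  show ?thesis
    by (rule integrable_const_bound[OF AE_I2 meas]) (use b space_circle_lebesgue in auto)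
qed

lemma circle_lebesgue_moment:
  assumes "k \<ge> 1"
  shows "(\<integral>z. z^k \<partial>circle_lebesgue) = 0"
proof -
  have int: "integrable circle_lebesgue (\<lambda>z. z^k)"
    by (intro circle_lebesgue_integrable continuous_intros)
  have "(\<integral>z. z^k \<partial>circle_lebesgue) = (\<integral>t. cis t ^ k \<partial>restrict_space lborel {0..<2*pi})"
    using int unfolding circle_lebesgue_def
    by (subst integral_distr[OF measurable_cis_circle]) (auto simp: integrable_distr_eq[OF measurable_cis_circle] dest: borel_measurable_integrable)
  also have "\<dots> = (\<integral>t. indicator {0..<2*pi} t *\<^sub>R cis t ^ k \<partial>lborel)"
    by (subst integral_restrict_space) auto
  \<comment> \<open>The fundamental theorem of calculus is applied on a closed interval; the added
    endpoint is a null set.\<close>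
  also have "\<dots> = (\<integral>t. indicator {0..2*pi} t *\<^sub>R cis (real k * t) \<partial>lborel)"
  proof (rule integral_cong_AE)
    have "AE t in lborel. t \<noteq> 2 * pi" by (rule AE_lborel_singleton)
    then show "AE t in lborel. indicator {0..<2*pi} t *\<^sub>R cis t ^ k = indicator {0..2*pi} t *\<^sub>R cis (real k * t)"
      by eventually_elim (auto simp: indicator_def Complex.DeMoivre)
    show "(\<lambda>t. indicator {0..<2*pi} t *\<^sub>R cis t ^ k) \<in> borel_measurable lborel"
      "(\<lambda>t. indicator {0..2*pi} t *\<^sub>R cis (real k * t)) \<in> borel_measurable lborel"
      by (simp_all, (intro borel_measurable_scaleR borel_measurable_indicator borel_measurable_continuous_onI continuous_intros; simp)+)
  qed
  also have "\<dots> = cis (real k * (2*pi)) / (\<i> * k) - cis (real k * 0) / (\<i> * k)"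
  proof (rule integral_FTC_Icc)
    fix t :: real
    have "((\<lambda>t. cis (real k * t)) has_vector_derivative \<i> * k * cis (real k * t)) (at t)"
      unfolding has_vector_derivative_def
      by (rule has_derivative_eq_rhs[OF has_derivative_cis[OF has_derivative_mult_right[OF has_derivative_ident]]])
         (auto simp: fun_eq_iff scaleR_conv_of_real)
    then have "((\<lambda>t. cis (real k * t) / (\<i> * k)) has_vector_derivative (\<i> * k * cis (real k * t)) / (\<i> * k)) (at t)"
      by (rule has_vector_derivative_divide)
    moreover have "(\<i> * k * cis (real k * t)) / (\<i> * k) = cis (real k * t)"
      using assms by simp
    ultimately show "((\<lambda>t. cis (real k * t) / (\<i> * k)) has_vector_derivative cis (real k * t)) (at t within {0..2*pi})"
      by (metis has_vector_derivative_at_within)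
  next
   show "continuous_on {0..2*pi} (\<lambda>t. cis (real k * t))" by (intro continuous_intros)
  qed simp
  also have "\<dots> = 0"
    using cis_multiple_2pi[of "real k"] by (simp add: mult.commute)
  finally show ?thesis .
qed

text \<open>Real and imaginary part are combinations of \<open>z\<close> and \<open>cnj z\<close>,
  which are inverse to each other on the circle. Hence the approximants of Stone-Weierstrass are
  Laurent polynomials there, and moments in powers of \<open>z\<close> decide about them.\<close>

lemma real_polynomial_function_on_circle:
  assumes "real_polynomial_function p"
  shows "\<exists>m P. \<forall>z\<in>sphere 0 1. complex_of_real (p z) = cnj z ^ m * poly P z"
  using assms
proof (induction rule: real_polynomial_function.induct)
  case (linear f)
  let ?a = "complex_of_real (f 1)" and ?b = "complex_of_real (f \<i>)"
  show ?case
  proof (intro exI ballI)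
    fix z :: complex assume "z \<in> sphere 0 1"
    then have 1: "cnj z * z = 1" using complex_norm_square[of z] by (simp add: mult.commute)
    have "f z = f (Re z *\<^sub>R 1 + Im z *\<^sub>R \<i>)"
      by (rule arg_cong[of _ _ f]) (simp add: complex_eq_iff)
    also have "\<dots> = Re z * f 1 + Im z * f \<i>"
      using linear by (simp add: linear_simps)
    finally have "complex_of_real (f z) = complex_of_real (Re z) * ?a + complex_of_real (Im z) * ?b"
      by simp
    \<comment> \<open>Here \<open>Re z = (z + cnj z) / 2\<close> and
      \<open>Im z = (z - cnj z) / (2 * \<i>)\<close>.\<close>
    also have "\<dots> = cnj z * (?a / 2 - ?b / (2 * \<i>)) + z * (?a / 2 + ?b / (2 * \<i>))"
      by (simp add: complex_eq_iff field_simps)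
    also have "\<dots> = cnj z * (?a / 2 - ?b / (2 * \<i>)) + (cnj z * z) * z * (?a / 2 + ?b / (2 * \<i>))"
      by (simp only: 1 mult_1_left)
    also have "\<dots> = cnj z ^ 1 * poly [:?a / 2 - ?b / (2 * \<i>), 0, ?a / 2 + ?b / (2 * \<i>):] z"
      by (simp add: algebra_simps)
    finally show "complex_of_real (f z) = cnj z ^ 1 * poly [:?a / 2 - ?b / (2 * \<i>), 0, ?a / 2 + ?b / (2 * \<i>):] z" .
  qed
next
  case (const a)
  show ?case by (intro exI[of _ 0] exI[of _ "[:complex_of_real a:]"]) simp
next
  case (add f g)
  then obtain m P m' P' where
    f: "\<And>z. z \<in> sphere 0 1 \<Longrightarrow> complex_of_real (f z) = cnj z ^ m * poly P z" and
    g: "\<And>z. z \<in> sphere 0 1 \<Longrightarrow> complex_of_real (g z) = cnj z ^ m' * poly P' z" by blast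
  show ?case
  proof (intro exI ballI)
    fix z :: complex assume z: "z \<in> sphere 0 1"
    then have 1: "cnj z * z = 1" using complex_norm_square[of z] by (simp add: mult.commute)
    \<comment> \<open>Powers of \<open>cnj z * z = 1\<close> bring both summands to the common
      factor \<open>cnj z ^ (m + m')\<close>.\<close>
    have "complex_of_real (f z + g z) = (cnj z * z) ^ m' * (cnj z ^ m * poly P z) + (cnj z * z) ^ m * (cnj z ^ m' * poly P' z)"
      by (simp only: 1 power_one mult_1_left of_real_add f[OF z] g[OF z])
    also have "\<dots> = cnj z ^ (m + m') * poly (monom 1 m' * P + monom 1 m * P') z"
      by (simp add: poly_monom power_add power_mult_distrib algebra_simps)
    finally show "complex_of_real (f z + g z) = cnj z ^ (m + m') * poly (monom 1 m' * P + monom 1 m * P') z" .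
  qed
next
  case (mult f g)
  then obtain m P m' P' where
    f: "\<And>z. z \<in> sphere 0 1 \<Longrightarrow> complex_of_real (f z) = cnj z ^ m * poly P z" and
    g: "\<And>z. z \<in> sphere 0 1 \<Longrightarrow> complex_of_real (g z) = cnj z ^ m' * poly P' z" by blast
  show ?case
  proof (intro exI ballI)
    fix z :: complex assume z: "z \<in> sphere 0 1"
    show "complex_of_real (f z * g z) = cnj z ^ (m + m') * poly (P * P') z"
      by (simp add: f[OF z] g[OF z] power_add)
  qed
qed

section \<open>Asymptotic proportionality to Lebesgue measure\<close>

context szego_polys
begin

lemma moments_tendsto:
  assumes "\<alpha> \<longlonglongrightarrow> 0" "k \<ge> 1"
  shows "(\<lambda>N. \<integral>z. z^k * complex_of_real ((cmod (\<phi> N z))\<^sup>2) \<partial>M) \<longlonglongrightarrow> 0"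
proof (rule Lim_null_comparison)
  show "\<forall>\<^sub>F N in sequentially. norm (\<integral>z. z^k * complex_of_real ((cmod (\<phi> N z))\<^sup>2) \<partial>M)
      \<le> (\<Sum>n\<in>{N..<N+k}. cmod (\<alpha> n))"
    using moment_le[OF assms(2)] by (intro always_eventually allI)
  have "(\<Sum>n\<in>{N..<N+k}. cmod (\<alpha> n)) = (\<Sum>i<k. cmod (\<alpha> (i + N)))" for N
    using sum.shift_bounds_nat_ivl[of "\<lambda>n. cmod (\<alpha> n)" 0 N k]
    by (simp add: lessThan_atLeast0 add.commute)
  moreover have "(\<lambda>N. \<Sum>i<k. cmod (\<alpha> (i + N))) \<longlonglongrightarrow> (\<Sum>i<k. 0)"
  proof (intro tendsto_sum)
    fix i
    have "(\<lambda>N. \<alpha> (N + i)) \<longlonglongrightarrow> 0" using assms(1) by (rule LIMSEQ_ignore_initial_segment)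
    then show "(\<lambda>N. cmod (\<alpha> (i + N))) \<longlonglongrightarrow> 0" by (simp add: tendsto_norm_zero add.commute)
  qed
  ultimately show "(\<lambda>N. \<Sum>n\<in>{N..<N+k}. cmod (\<alpha> n)) \<longlonglongrightarrow> 0" by simp
qed

text \<open>The deviation of \<open>(cmod (\<phi> N z))^2\<close> times \<open>M\<close> from the
  multiple of Lebesgue measure of the same mass \<open>c N\<close>. Keeping \<open>c N\<close> in
  the formula makes the deviation vanish on constants and bypasses the question of a limit of
  \<open>c N\<close>.\<close>

definition defect where
  "defect f N = (\<integral>z. f z * complex_of_real ((cmod (\<phi> N z))\<^sup>2) \<partial>M)
     - complex_of_real (c N / (2 * pi)) * (\<integral>z. f z \<partial>circle_lebesgue)"

lemma defect_cong:
  assumes "\<And>z. z \<in> sphere 0 1 \<Longrightarrow> f z = g z"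
  shows "defect f = defect g"
proof
  fix N
  have "(\<integral>z. f z * complex_of_real ((cmod (\<phi> N z))\<^sup>2) \<partial>M) = (\<integral>z. g z * complex_of_real ((cmod (\<phi> N z))\<^sup>2) \<partial>M)"
    by (rule Bochner_Integration.integral_cong) (auto simp: space_M assms)
  moreover have "(\<integral>z. f z \<partial>circle_lebesgue) = (\<integral>z. g z \<partial>circle_lebesgue)"
    by (rule Bochner_Integration.integral_cong) (auto simp: space_circle_lebesgue assms)
  ultimately show "defect f N = defect g N" by (simp add: defect_def)
qed

lemma defect_power:
  assumes "\<alpha> \<longlonglongrightarrow> 0"
  shows "defect (\<lambda>z. z^k) \<longlonglongrightarrow> 0"
proof (cases "k = 0")
  case True
  have "defect (\<lambda>z. z^k) = (\<lambda>N. 0)"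
  proof
    fix N
    have "(\<integral>z. complex_of_real ((cmod (\<phi> N z))\<^sup>2) \<partial>M) = complex_of_real (c N)"
      by (simp only: integral_complex_of_real c_def)
    then show "defect (\<lambda>z. z^k) N = 0"
      using True by (simp add: defect_def space_circle_lebesgue measure_circle_lebesgue_space scaleR_conv_of_real)
  qed
  then show ?thesis by simp
next
  case False
  then have "defect (\<lambda>z. z^k) = (\<lambda>N. \<integral>z. z^k * complex_of_real ((cmod (\<phi> N z))\<^sup>2) \<partial>M)"
    unfolding defect_def using circle_lebesgue_moment[of k] by simp
  then show ?thesis using moments_tendsto[OF assms, of k] False by simp
qed

lemma defect_cnj: "defect (\<lambda>z. cnj (f z)) N = cnj (defect f N)"
  unfolding defect_def by (simp flip: Bochner_Integration.integral_cnj)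

lemma defect_trig_monomial:
  assumes "\<alpha> \<longlonglongrightarrow> 0"
  shows "defect (\<lambda>z. cnj z ^ m * z ^ i) \<longlonglongrightarrow> 0"
proof (cases "m \<le> i")
  case True
  have "defect (\<lambda>z. cnj z ^ m * z ^ i) = defect (\<lambda>z. z ^ (i - m))"
  proof (rule defect_cong)
    fix z :: complex assume z: "z \<in> sphere 0 1"
    have "cnj z ^ m * z ^ i = (z * cnj z)^m * z^(i - m)"
      using True by (simp add: power_mult_distrib mult_ac flip: power_add)
    then show "cnj z ^ m * z ^ i = z ^ (i - m)"
      by (simp only: circle_cnj[OF z] power_one mult_1_left)
  qed
  then show ?thesis using defect_power[OF assms] by simp
next
  case False
  have "defect (\<lambda>z. cnj z ^ m * z ^ i) = defect (\<lambda>z. cnj (z ^ (m - i)))"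
  proof (rule defect_cong)
    fix z :: complex assume z: "z \<in> sphere 0 1"
    have "cnj z ^ m * z ^ i = (z * cnj z)^i * cnj z^(m - i)"
      using False by (simp add: power_mult_distrib mult_ac flip: power_add)
    then show "cnj z ^ m * z ^ i = cnj (z ^ (m - i))"
      by (simp only: circle_cnj[OF z] power_one mult_1_left complex_cnj_power)
  qed
  moreover have "(\<lambda>N. cnj (defect (\<lambda>z. z ^ (m - i)) N)) \<longlonglongrightarrow> cnj 0"
    by (intro tendsto_cnj defect_power assms)
  ultimately show ?thesis by (simp only: defect_cnj[symmetric] complex_cnj_zero)
qed

lemma defect_sum:
  assumes "finite I" "\<And>i. i \<in> I \<Longrightarrow> continuous_on (sphere 0 1) (f i)"
  shows "defect (\<lambda>z. \<Sum>i\<in>I. a i * f i z) N = (\<Sum>i\<in>I. a i * defect (f i) N)"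
proof -
  have "(\<integral>z. (\<Sum>i\<in>I. a i * f i z) * complex_of_real ((cmod (\<phi> N z))\<^sup>2) \<partial>M)
      = (\<integral>z. (\<Sum>i\<in>I. a i * (f i z * complex_of_real ((cmod (\<phi> N z))\<^sup>2))) \<partial>M)"
    by (simp only: sum_distrib_right mult.assoc)
  also have "\<dots> = (\<Sum>i\<in>I. \<integral>z. a i * (f i z * complex_of_real ((cmod (\<phi> N z))\<^sup>2)) \<partial>M)"
    using assms by (intro Bochner_Integration.integral_sum continuous_integrable continuous_intros)
  moreover have "(\<integral>z. (\<Sum>i\<in>I. a i * f i z) \<partial>circle_lebesgue) = (\<Sum>i\<in>I. \<integral>z. a i * f i z \<partial>circle_lebesgue)"
    using assms by (intro Bochner_Integration.integral_sum circle_lebesgue_integrable continuous_intros)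
  ultimately show ?thesis
    unfolding defect_def right_diff_distrib sum_subtractf
    by (simp only: integral_mult_right_zero sum_distrib_left mult.left_commute)
qed

lemma defect_real_polynomial:
  assumes "\<alpha> \<longlonglongrightarrow> 0" "real_polynomial_function p"
  shows "defect (\<lambda>z. complex_of_real (p z)) \<longlonglongrightarrow> 0"
proof -
  obtain m P where P: "\<And>z. z \<in> sphere 0 1 \<Longrightarrow> complex_of_real (p z) = cnj z ^ m * poly P z"
    using real_polynomial_function_on_circle[OF assms(2)] by blast
  have "defect (\<lambda>z. complex_of_real (p z))
      = defect (\<lambda>z. \<Sum>i\<le>degree P. coeff P i * (cnj z ^ m * z ^ i))"
    by (rule defect_cong) (simp add: P poly_altdef sum_distrib_left mult_ac)
  also have "\<dots> = (\<lambda>N. \<Sum>i\<le>degree P. coeff P i * defect (\<lambda>z. cnj z ^ m * z ^ i) N)"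
    by (rule ext) (intro defect_sum finite_atMost continuous_intros)
  also have "\<dots> \<longlonglongrightarrow> (\<Sum>i\<le>degree P. coeff P i * 0)"
    by (intro tendsto_intros defect_trig_monomial assms)
  finally show ?thesis by simp
qed

end

text \<open>The tent functions \<open>max 0 (1 - i * infdist z K)\<close> equal 1 on
  \<open>K\<close> and tend to 0 off the closed set \<open>K\<close>, so dominated convergence makes
  their integrals tend to the measure of \<open>K\<close>.\<close>

lemma continuous_majorant_of_null_set:
  assumes "compact K" "K \<in> null_sets circle_lebesgue" "e > 0"
  obtains h :: "complex \<Rightarrow> real" where "continuous_on UNIV h" "\<And>z. 0 \<le> h z" "\<And>z. indicator K z \<le> h z"
    "(\<integral>z. h z \<partial>circle_lebesgue) < e"
proof (cases "K = {}")
  \<comment> \<open>The distance to the empty set is 0 by convention, so the tent functions would be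
    constantly 1.\<close>
  case True
  then show ?thesis using assms(3) by (intro that[of "\<lambda>_. 0"]) auto
next
  case False
  interpret finite_measure circle_lebesgue by (rule finite_measure_circle_lebesgue)
  define h where "h i z = max 0 (1 - real i * infdist z K)" for i :: nat and z :: complex
  have cont: "continuous_on A (h i)" for A i unfolding h_def by (intro continuous_intros)
  have "(\<lambda>i. \<integral>z. h i z \<partial>circle_lebesgue) \<longlonglongrightarrow> (\<integral>z. indicator K z \<partial>circle_lebesgue)"
  proof (rule integral_dominated_convergence[where w = "\<lambda>_. 1"])
    show "AE z in circle_lebesgue. (\<lambda>i. h i z) \<longlonglongrightarrow> indicator K z"
    proof (rule AE_I2)
      fix z
      show "(\<lambda>i. h i z) \<longlonglongrightarrow> indicator K z"
      proof (cases "z \<in> K")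
        case True
        then show ?thesis by (simp add: h_def)
      next
        case False
        then have d: "infdist z K > 0"
          using \<open>K \<noteq> {}\<close> assms(1) by (simp add: infdist_pos_not_in_closed compact_imp_closed)
        obtain n :: nat where "1 / infdist z K < n" using reals_Archimedean2 by blast
        then have "1 < real n * infdist z K" using d by (simp add: field_simps)
        have "h i z = 0" if "i \<ge> n" for i
        proof -
          have "real n * infdist z K \<le> real i * infdist z K"
            using that d by (intro mult_right_mono) auto
          then have "1 - real i * infdist z K \<le> 0"
            using \<open>1 < real n * infdist z K\<close> by linarith
          then show ?thesis by (simp only: h_def max_absorb1)
        qed
        then have "eventually (\<lambda>i. h i z = 0) sequentially"
          unfolding eventually_sequentially by blast
        then show ?thesis using False by (simp add: tendsto_eventually)
      qed
    qed
    show "(\<lambda>z. indicator K z :: real) \<in> borel_measurable circle_lebesgue"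
      using assms(2) by (intro borel_measurable_indicator) (auto dest: null_setsD2)
    show "h i \<in> borel_measurable circle_lebesgue" for i
      by (intro borel_measurable_integrable circle_lebesgue_integrable cont)
    show "AE z in circle_lebesgue. norm (h i z) \<le> 1" for i
      by (intro AE_I2) (simp add: h_def infdist_nonneg)
  qed simp
  also have "(\<integral>z. indicator K z \<partial>circle_lebesgue) = (0::real)"
    using assms(2) by (simp add: null_sets_def measure_def)
  finally have "eventually (\<lambda>i. (\<integral>z. h i z \<partial>circle_lebesgue) < e) sequentially"
    using assms(3) by (rule order_tendstoD)
  then obtain i where "(\<integral>z. h i z \<partial>circle_lebesgue) < e"
    unfolding eventually_sequentially by blast
  then show ?thesis
    by (intro that[of "h i"]) (use cont in \<open>auto simp: h_def indicator_def\<close>)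
qed

text \<open>The indicator lies below a continuous function of small Lebesgue integral, hence below a
  polynomial plus a small constant on the circle. For the polynomial the \<open>defect\<close> tends
  to 0 and \<open>c N \<le> 1\<close>.\<close>

lemma (in szego_polys) null_compact_tendsto_0:
  assumes \<alpha>: "\<alpha> \<longlonglongrightarrow> 0" and K: "compact K" "K \<in> null_sets circle_lebesgue"
  shows "(\<lambda>N. \<integral>z. indicator K z * (cmod (\<phi> N z))\<^sup>2 \<partial>M) \<longlonglongrightarrow> 0"
proof (rule order_tendstoI)
  fix e :: real assume "e < 0"
  moreover have "0 \<le> (\<integral>z. indicator K z * (cmod (\<phi> N z))\<^sup>2 \<partial>M)" for N by simp
  ultimately show "\<forall>\<^sub>F N in sequentially. e < (\<integral>z. indicator K z * (cmod (\<phi> N z))\<^sup>2 \<partial>M)"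
    by (intro always_eventually allI) (rule less_le_trans)
next
  fix e :: real assume e: "0 < e"
  \<comment> \<open>The approximation costs less than \<open>4 * d\<close>; the fifth
    \<open>d\<close> is left for the \<open>defect\<close>, which is eventually smaller.\<close>
  define d where "d = e / 5"
  have d: "d > 0" using e by (simp add: d_def)
  obtain h where h: "continuous_on UNIV h" "\<And>z. 0 \<le> h z" "\<And>z. indicator K z \<le> h z"
    "(\<integral>z. h z \<partial>circle_lebesgue) < d"
    using continuous_majorant_of_null_set[OF K d] by metis
  have hc: "continuous_on (sphere 0 1) h" using h(1) by (rule continuous_on_subset) simp
  obtain p where p: "real_polynomial_function p" "\<And>z. z \<in> sphere 0 1 \<Longrightarrow> \<bar>h z - p z\<bar> < d"
    using Stone_Weierstrass_real_polynomial_function[OF compact_sphere hc d] by metis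
  have pc: "continuous_on (sphere 0 1) p"
    using p(1) by (intro continuous_on_polymonial_function) (simp add: real_polynomial_function_eq)
  interpret L: finite_measure circle_lebesgue by (rule finite_measure_circle_lebesgue)
  have "(\<integral>z. p z \<partial>circle_lebesgue) \<le> (\<integral>z. h z + d \<partial>circle_lebesgue)"
  proof (rule integral_mono)
    show "p z \<le> h z + d" if "z \<in> space circle_lebesgue" for z
      using p(2)[of z] that unfolding space_circle_lebesgue by linarith
  qed (intro circle_lebesgue_integrable continuous_intros hc pc)+
  also have "\<dots> = (\<integral>z. h z \<partial>circle_lebesgue) + d * (2 * pi)"
    by (subst Bochner_Integration.integral_add)
       (auto intro!: circle_lebesgue_integrable hc simp: space_circle_lebesgue measure_circle_lebesgue_space)
  finally have pint: "(\<integral>z. p z \<partial>circle_lebesgue) \<le> d * (1 + 2 * pi)"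
    using h(4) by (simp add: algebra_simps)
  have bound: "(\<integral>z. indicator K z * (cmod (\<phi> N z))\<^sup>2 \<partial>M) < 4 * d + cmod (defect (\<lambda>z. complex_of_real (p z)) N)" for N
  proof -
    have Kmeas: "K \<in> sets M" using K(2) by (simp add: null_sets_def sets_circle_lebesgue sets_M)
    have ic: "integrable M (\<lambda>z. (cmod (\<phi> N z))\<^sup>2)"
      by (intro continuous_integrable continuous_intros)
    have ip: "integrable M (\<lambda>z. p z * (cmod (\<phi> N z))\<^sup>2)"
      by (intro continuous_integrable continuous_intros pc)
    have "(\<integral>z. indicator K z * (cmod (\<phi> N z))\<^sup>2 \<partial>M) \<le> (\<integral>z. p z * (cmod (\<phi> N z))\<^sup>2 + d * (cmod (\<phi> N z))\<^sup>2 \<partial>M)"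
    proof (rule integral_mono)
      show "integrable M (\<lambda>z. indicator K z * (cmod (\<phi> N z))\<^sup>2)"
        using integrable_mult_indicator[OF Kmeas ic] by simp
      show "integrable M (\<lambda>z. p z * (cmod (\<phi> N z))\<^sup>2 + d * (cmod (\<phi> N z))\<^sup>2)"
        using ic ip by simp
      fix z assume "z \<in> space M"
      then have "indicator K z \<le> p z + d"
        using p(2)[of z] h(3)[of z] unfolding space_M by linarith
      then have "indicator K z * (cmod (\<phi> N z))\<^sup>2 \<le> (p z + d) * (cmod (\<phi> N z))\<^sup>2"
        by (intro mult_right_mono) auto
      then show "indicator K z * (cmod (\<phi> N z))\<^sup>2 \<le> p z * (cmod (\<phi> N z))\<^sup>2 + d * (cmod (\<phi> N z))\<^sup>2"
        by (simp add: algebra_simps)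
    qed
    also have "\<dots> = (\<integral>z. p z * (cmod (\<phi> N z))\<^sup>2 \<partial>M) + d * c N"
      using ic ip by (simp add: c_def)
    also have "(\<integral>z. p z * (cmod (\<phi> N z))\<^sup>2 \<partial>M)
        = Re (defect (\<lambda>z. complex_of_real (p z)) N) + c N / (2 * pi) * (\<integral>z. p z \<partial>circle_lebesgue)"
      unfolding defect_def of_real_mult[symmetric] integral_complex_of_real by simp
    also have "c N / (2 * pi) * (\<integral>z. p z \<partial>circle_lebesgue) \<le> c N / (2 * pi) * (d * (1 + 2 * pi))"
      using pint c_nonneg by (intro mult_left_mono) auto
    also have "\<dots> \<le> 1 / (2 * pi) * (d * (1 + 2 * pi))"
      using c_le_1 d by (intro mult_right_mono divide_right_mono) auto
    also have "\<dots> = d * (1 / (2 * pi) + 1)" by (simp add: field_simps)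
    also have "\<dots> < d * (1 + 1)"
      using d pi_gt3 by (intro mult_strict_left_mono add_strict_right_mono) auto
    also have "Re (defect (\<lambda>z. complex_of_real (p z)) N) \<le> cmod (defect (\<lambda>z. complex_of_real (p z)) N)"
      by (rule complex_Re_le_cmod)
    also have "d * c N \<le> d * 1" using c_le_1 d by (intro mult_left_mono) auto
    finally show ?thesis using d by simp
  qed
  have "(\<lambda>N. cmod (defect (\<lambda>z. complex_of_real (p z)) N)) \<longlonglongrightarrow> 0"
    using defect_real_polynomial[OF \<alpha> p(1)] by (rule tendsto_norm_zero)
  then have "\<forall>\<^sub>F N in sequentially. cmod (defect (\<lambda>z. complex_of_real (p z)) N) < d"
    using d by (rule order_tendstoD)
  then show "\<forall>\<^sub>F N in sequentially. (\<integral>z. indicator K z * (cmod (\<phi> N z))\<^sup>2 \<partial>M) < e"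
  proof eventually_elim
    case (elim N)
    then show ?case using bound[of N] unfolding d_def by linarith
  qed
qed

section \<open>Absence of a singular part\<close>

locale coulomb_polys = szego_polys M \<Phi> \<alpha> + coulomb_decay \<alpha> for M \<Phi> \<alpha>
begin

lemma szego_orbit_\<phi>: "z \<in> sphere 0 1 \<Longrightarrow> szego_orbit \<alpha> z (\<lambda>n. \<phi> n z)"
  by unfold_locales (auto simp: \<phi>_0 \<phi>_Suc v_def)

lemma singleton_sets: "w \<in> sphere 0 1 \<Longrightarrow> {w} \<in> sets M"
  unfolding sets_M circle_borel_def by (subst sets_restrict_space_iff) auto

text \<open>A point of positive mass would make the squares \<open>(cmod (\<phi> n w))^2\<close>
  summable by \<open>atom_bound\<close>, whereas along the orbit they are at least
  \<open>a / n\<close>.\<close>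

lemma no_atoms: "measure M {w} = 0"
proof (cases "w \<in> sphere 0 1")
  case False
  then show ?thesis by (intro measure_notin_sets) (use sets.sets_into_space space_M in blast)
next
  case True
  interpret orbit: szego_orbit \<alpha> w "\<lambda>n. \<phi> n w" by (rule szego_orbit_\<phi>) fact
  obtain a where a: "a > 0" "\<And>N. N \<ge> 2 \<Longrightarrow> a / real N \<le> (cmod (\<phi> N w))\<^sup>2"
    using orbit.norm_lower_bound by blast
  show ?thesis
  proof (rule ccontr)
    assume "measure M {w} \<noteq> 0"
    then have m: "measure M {w} > 0" by (simp add: zero_less_measure_iff)
    have "summable (\<lambda>n. (cmod (\<phi> n w))\<^sup>2)"
    proof (rule summableI_nonneg_bounded)
      show "(\<Sum>n<N. (cmod (\<phi> n w))\<^sup>2) \<le> 1 / measure M {w}" for N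
        using atom_bound[of w N] m by (simp add: field_simps)
    qed simp
    then have "summable (\<lambda>n. a / real n)"
      by (rule summable_comparison_test'[where N = 2]) (use a in auto)
    then have "summable (\<lambda>n. inverse a * (a / real n))" by (rule summable_mult)
    then have "summable (\<lambda>n. inverse (real n))" using a(1) by (simp add: field_simps inverse_eq_divide)
    then show False using not_summable_harmonic[where ?'a = real] by blast
  qed
qed

text \<open>Compare index \<open>2^j\<close> with \<open>2^k\<close>: the integral over
  \<open>K\<close> is at most twice that for \<open>2^k\<close> plus twice the squared norm of the
  difference of the reversed polynomials. As \<open>k\<close> grows the first term vanishes, and the
  second is bounded by the coefficient tail uniformly in \<open>k\<close>.\<close>

lemma null_compact_decay:
  assumes "compact K" "K \<in> null_sets circle_lebesgue" "j \<ge> 1"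
  shows "(\<integral>z. indicator K z * (cmod (\<phi> (2^j) z))\<^sup>2 \<partial>M) \<le> (real j + 2) / 2^j"
proof -
  define I where "I k = (\<integral>z. indicator K z * (cmod (\<phi> (2^k) z))\<^sup>2 \<partial>M)" for k :: nat
  have Kmeas: "K \<in> sets M" using assms(2) by (simp add: null_sets_def sets_circle_lebesgue sets_M)
  have int: "integrable M (\<lambda>z. indicator K z * (cmod (\<phi> n z))\<^sup>2)" for n
    using integrable_mult_indicator[OF Kmeas, of "\<lambda>z. (cmod (\<phi> n z))\<^sup>2"]
    by (simp add: continuous_integrable continuous_intros)
  have "I j \<le> 2 * I k + (real j + 2) / 2^j" if "k \<ge> j" for k
  proof -
    define n where "n = (2::nat)^k - 2^j"
    have n: "2^j + n = 2^k" using that by (simp add: n_def)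
    have intd: "integrable M (\<lambda>z. (cmod (v (2^j) z - v (2^j + n) z))\<^sup>2)"
      by (intro continuous_integrable continuous_intros)
    have "I j \<le> (\<integral>z. 2 * (indicator K z * (cmod (\<phi> (2^k) z))\<^sup>2) + 2 * (cmod (v (2^j) z - v (2^j + n) z))\<^sup>2 \<partial>M)"
      unfolding I_def
    proof (rule integral_mono)
      fix z assume "z \<in> space M"
      then have z: "z \<in> sphere 0 1" by (simp add: space_M)
      have "cmod (\<phi> (2^j) z) \<le> cmod (\<phi> (2^k) z) + cmod (v (2^j) z - v (2^j + n) z)"
        using norm_triangle_sub[of "v (2^j) z" "v (2^k) z"] by (simp add: norm_v[OF z, symmetric] n)
      then have "(cmod (\<phi> (2^j) z))\<^sup>2 \<le> (cmod (\<phi> (2^k) z) + cmod (v (2^j) z - v (2^j + n) z))\<^sup>2"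
        by (rule power_mono) simp
      also have "\<dots> \<le> 2 * (cmod (\<phi> (2^k) z))\<^sup>2 + 2 * (cmod (v (2^j) z - v (2^j + n) z))\<^sup>2"
        using sum_squares_bound[of "cmod (\<phi> (2^k) z)" "cmod (v (2^j) z - v (2^j + n) z)"]
        by (simp only: power2_sum)
      finally show "indicator K z * (cmod (\<phi> (2^j) z))\<^sup>2
          \<le> 2 * (indicator K z * (cmod (\<phi> (2^k) z))\<^sup>2) + 2 * (cmod (v (2^j) z - v (2^j + n) z))\<^sup>2"
        by (auto simp: indicator_def)
    qed (use int intd in auto)
    also have "\<dots> = 2 * I k + 2 * (\<integral>z. (cmod (v (2^j) z - v (2^j + n) z))\<^sup>2 \<partial>M)"
      using int intd by (simp add: I_def)
    also have "(\<integral>z. (cmod (v (2^j) z - v (2^j + n) z))\<^sup>2 \<partial>M) \<le> (\<Sum>i\<in>{2^j..<2^k}. (cmod (\<alpha> i))\<^sup>2)"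
      using v_diff_norm_le[of "2^j" n] by (simp only: n)
    also have "\<dots> \<le> (real j + 2) / 2^(j+1)"
      using assms(3) that by (rule dyadic_tail_le)
    finally have "I j \<le> 2 * I k + 2 * ((real j + 2) / 2^(j+1))" by simp
    also have "2 * ((real j + 2) / 2^(j+1)) = (real j + 2) / 2^j" by (simp add: field_simps)
    finally show ?thesis .
  qed
  moreover have "(\<lambda>k. 2 * I k + (real j + 2) / 2^j) \<longlonglongrightarrow> 2 * 0 + (real j + 2) / 2^j"
  proof (intro tendsto_intros)
    have "filterlim (\<lambda>k::nat. (2::nat)^k) sequentially sequentially"
      by (rule filterlim_subseq) (simp add: strict_mono_def)
    then show "I \<longlonglongrightarrow> 0"
      unfolding I_def
      by (rule filterlim_compose[OF null_compact_tendsto_0[OF alpha_tendsto_0 assms(1,2)]])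
  qed
  ultimately have "I j \<le> 2 * 0 + (real j + 2) / 2^j"
    by (intro LIMSEQ_le_const) auto
  then show ?thesis by (simp add: I_def)
qed

text \<open>Borel--Cantelli along the dyadic subsequence.\<close>

lemma AE_dyadic_decay:
  assumes "compact K" "K \<in> null_sets circle_lebesgue"
  shows "AE z in M. z \<in> K \<longrightarrow>
    (\<exists>D. \<forall>j\<ge>1. 3/4 * ln (real (2^j)) - D \<le> - ln ((cmod (\<phi> (2^j) z))\<^sup>2))"
proof -
  \<comment> \<open>The exponent 3/4 is below 1, so that \<open>\<rho>^j * (j + 2) / 2^j\<close> is
    summable, and twice 3/4 exceeds the 17/12 available to two orbits.\<close>
  define \<rho> where "\<rho> = (2::real) powr (3/4)"
  have \<rho>: "0 < \<rho>" "\<rho> < 2"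
    using powr_less_mono[of "3/4" 1 2] by (simp_all add: \<rho>_def)
  \<comment> \<open>The shift to \<open>Suc j\<close> is there because the decay bound starts at
    index 1.\<close>
  define f where "f j z = \<rho>^Suc j * (indicator K z * (cmod (\<phi> (2^Suc j) z))\<^sup>2)" for j z
  have Kmeas: "K \<in> sets M" using assms(2) by (simp add: null_sets_def sets_circle_lebesgue sets_M)
  have int: "integrable M (f j)" for j
    using integrable_mult_indicator[OF Kmeas, of "\<lambda>z. (cmod (\<phi> (2^Suc j) z))\<^sup>2"]
    unfolding f_def by (intro integrable_mult_right) (simp add: continuous_integrable continuous_intros)
  have f_nn: "0 \<le> f j z" for j z using \<rho> by (simp add: f_def)
  have f_int: "(\<integral>z. f j z \<partial>M) \<le> 3 * (real (Suc j) * (\<rho>/2)^j)" for j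
  proof -
    have "(\<integral>z. f j z \<partial>M) \<le> \<rho>^Suc j * ((real (Suc j) + 2) / 2^Suc j)"
      unfolding f_def using null_compact_decay[OF assms, of "Suc j"] \<rho>
      by (simp only: integral_mult_right_zero) (intro mult_left_mono; simp)
    also have "\<dots> = (\<rho>/2)^Suc j * (real (Suc j) + 2)" by (simp add: power_divide)
    also have "\<dots> \<le> (\<rho>/2)^j * (3 * real (Suc j))"
      using \<rho> by (intro mult_mono) (auto intro: power_decreasing)
    finally show ?thesis by (simp only: mult_ac)
  qed
  have sum: "summable (\<lambda>j. 3 * (real (Suc j) * (\<rho>/2)^j))"
    using geometric_deriv_sums[of "\<rho>/2"] \<rho> by (intro summable_mult) (auto simp: sums_iff)
  have "(\<integral>\<^sup>+z. (\<Sum>j. ennreal (f j z)) \<partial>M) = (\<Sum>j. \<integral>\<^sup>+z. ennreal (f j z) \<partial>M)"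
    using int by (intro nn_integral_suminf) auto
  also have "\<dots> = (\<Sum>j. ennreal (\<integral>z. f j z \<partial>M))"
    using int f_nn by (intro suminf_cong nn_integral_eq_integral) auto
  also have "\<dots> \<le> (\<Sum>j. ennreal (3 * (real (Suc j) * (\<rho>/2)^j)))"
    by (intro suminf_le ennreal_leI f_int) auto
  also have "\<dots> = ennreal (\<Sum>j. 3 * (real (Suc j) * (\<rho>/2)^j))"
    using sum \<rho> by (intro suminf_ennreal2) auto
  finally have "(\<integral>\<^sup>+z. (\<Sum>j. ennreal (f j z)) \<partial>M) \<noteq> \<infinity>"
    by (auto simp: top_unique)
  then have "AE z in M. (\<Sum>j. ennreal (f j z)) \<noteq> \<infinity>"
    using int by (intro nn_integral_noteq_infinite) auto
  then show ?thesis
  proof (rule AE_mp, intro AE_I2 impI)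
    fix z assume "z \<in> space M" and fin: "(\<Sum>j. ennreal (f j z)) \<noteq> \<infinity>" and K: "z \<in> K"
    then have z: "z \<in> sphere 0 1" by (simp add: space_M)
    interpret orbit: szego_orbit \<alpha> z "\<lambda>n. \<phi> n z" by (rule szego_orbit_\<phi>) fact
    obtain C where C: "C \<ge> 0" "(\<Sum>j. ennreal (f j z)) = ennreal C"
      using fin by (cases "\<Sum>j. ennreal (f j z)") auto
    have "ennreal (f j z) \<le> ennreal C" for j
      using sum_le_suminf[of "\<lambda>j. ennreal (f j z)" "{j}"] C by simp
    then have fC: "f j z \<le> C" for j using C(1) by simp
    \<comment> \<open>\<open>C + 1\<close> in place of \<open>C\<close> keeps the logarithm
      meaningful when \<open>C = 0\<close>.\<close>
    have "3/4 * ln (real (2^j)) - ln (C + 1) \<le> - ln ((cmod (\<phi> (2^j) z))\<^sup>2)" if "j \<ge> 1" for j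
    proof -
      have pos: "0 < (cmod (\<phi> (2^j) z))\<^sup>2" using orbit.x_nonzero by simp
      have "\<rho>^j * (cmod (\<phi> (2^j) z))\<^sup>2 \<le> C + 1"
        using fC[of "j - 1"] that K by (simp add: f_def)
      then have "ln (\<rho>^j * (cmod (\<phi> (2^j) z))\<^sup>2) \<le> ln (C + 1)"
        using pos \<rho> C(1) by (subst ln_le_cancel_iff) auto
      moreover have "ln (\<rho>^j * (cmod (\<phi> (2^j) z))\<^sup>2) = ln (\<rho>^j) + ln ((cmod (\<phi> (2^j) z))\<^sup>2)"
        using pos \<rho> by (simp add: ln_mult)
      moreover have "ln (\<rho>^j) = 3/4 * ln (real (2^j))"
        by (simp add: \<rho>_def ln_realpow ln_powr)
      ultimately show ?thesis by linarith
    qed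
    then show "\<exists>D. \<forall>j\<ge>1. 3/4 * ln (real (2^j)) - D \<le> - ln ((cmod (\<phi> (2^j) z))\<^sup>2)" by blast
  qed
qed

lemma dyadic_decay_unique:
  assumes "z \<in> sphere 0 1" "w \<in> sphere 0 1"
    and "\<forall>j\<ge>1. 3/4 * ln (real (2^j)) - D \<le> - ln ((cmod (\<phi> (2^j) z))\<^sup>2)"
    and "\<forall>j\<ge>1. 3/4 * ln (real (2^j)) - E \<le> - ln ((cmod (\<phi> (2^j) w))\<^sup>2)"
  shows "z = w"
proof (rule ccontr)
  assume "z \<noteq> w"
  then obtain C where C: "\<And>N. N \<ge> 2 \<Longrightarrow>
      - ln ((cmod (\<phi> N z))\<^sup>2) - ln ((cmod (\<phi> N w))\<^sup>2) \<le> 17/12 * ln (real N) + C"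
    using two_orbits_not_both_small[OF szego_orbit_\<phi>[OF assms(1)] szego_orbit_\<phi>[OF assms(2)]] by blast
  \<comment> \<open>The factor 12 is the inverse of the gap 3/2 - 17/12, so a second point would
    bound \<open>ln (2^j)\<close>.\<close>
  have bound: "real j * ln 2 \<le> 12 * (C + D + E)" if j: "j \<ge> 1" for j
  proof -
    have "(2::nat) \<le> 2^j" using self_le_power[of 2 j] j by simp
    then have "- ln ((cmod (\<phi> (2^j) z))\<^sup>2) - ln ((cmod (\<phi> (2^j) w))\<^sup>2) \<le> 17/12 * ln (real (2^j)) + C"
      by (rule C)
    moreover have "3/4 * ln (real (2^j)) - D \<le> - ln ((cmod (\<phi> (2^j) z))\<^sup>2)"
      "3/4 * ln (real (2^j)) - E \<le> - ln ((cmod (\<phi> (2^j) w))\<^sup>2)" using assms(3,4) j by blast+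
    ultimately have "ln (real (2^j)) \<le> 12 * (C + D + E)" by argo
    then show ?thesis by (simp add: ln_realpow)
  qed
  obtain j :: nat where "12 * (C + D + E) / ln 2 < j" using reals_Archimedean2 by blast
  then have "12 * (C + D + E) < real j * ln 2" by (simp add: field_simps)
  also have "\<dots> \<le> real (Suc j) * ln 2" by (intro mult_right_mono) auto
  finally show False using bound[of "Suc j"] by simp
qed

text \<open>Almost every point of \<open>K\<close> has the dyadic decay, but at most one point can
  have it, and a single point carries no mass.\<close>

lemma null_compact_measure:
  assumes "compact K" "K \<in> null_sets circle_lebesgue"
  shows "emeasure M K = 0"
proof -
  define good where
    "good z \<longleftrightarrow> (\<exists>D. \<forall>j\<ge>1. 3/4 * ln (real (2^j)) - D \<le> - ln ((cmod (\<phi> (2^j) z))\<^sup>2))" for z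
  have good: "AE z in M. z \<in> K \<longrightarrow> good z"
    unfolding good_def by (rule AE_dyadic_decay[OF assms])
  have Kmeas: "K \<in> sets M" using assms(2) by (simp add: null_sets_def sets_circle_lebesgue sets_M)
  then have K: "K \<subseteq> sphere 0 1" using sets.sets_into_space space_M by blast
  have "AE z in M. z \<notin> K"
  proof (cases "\<exists>w\<in>K. good w")
    case True
    then obtain w where w: "w \<in> K" "good w" by blast
    then have unique: "z = w" if z: "z \<in> K" "good z" for z
    proof -
      obtain D where D: "\<forall>j\<ge>1. 3/4 * ln (real (2^j)) - D \<le> - ln ((cmod (\<phi> (2^j) z))\<^sup>2)"
        using z(2) unfolding good_def by (elim exE)
      obtain E where E: "\<forall>j\<ge>1. 3/4 * ln (real (2^j)) - E \<le> - ln ((cmod (\<phi> (2^j) w))\<^sup>2)"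
        using w(2) unfolding good_def by (elim exE)
      show ?thesis
        by (rule dyadic_decay_unique[OF _ _ D E]) (use z(1) w(1) K in blast)+
    qed
    have "{w} \<in> null_sets M"
      using no_atoms[of w] singleton_sets[of w] w(1) K by (intro null_setsI) (auto simp: emeasure_eq_measure)
    then have "AE z in M. z \<notin> {w}" by (rule AE_not_in)
    with good show ?thesis by eventually_elim (use unique in blast)
  next
    case False
    from good show ?thesis by eventually_elim (use False in blast)
  qed
  moreover have "{z \<in> space M. \<not> z \<notin> K} = K" using K space_M by blast
  ultimately show ?thesis using AE_iff_measurable[OF Kmeas, of "\<lambda>z. z \<notin> K"] by iprover
qed

text \<open>By inner regularity the mass of a Lebesgue null set is the supremum over its compact
  subsets, which are null as well.\<close>

lemma absolutely_continuous: "absolutely_continuous circle_lebesgue M"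
  unfolding absolutely_continuous_def
proof
  fix B assume B: "B \<in> null_sets circle_lebesgue"
  have Bmeas: "B \<in> sets M" using B by (simp add: null_sets_def sets_circle_lebesgue sets_M)
  have Bborel: "B \<in> sets borel"
    using Bmeas unfolding sets_M circle_borel_def by (simp add: sets_restrict_space_iff)
  \<comment> \<open>Inner regularity is applied on the Borel sets of the plane, to which
    \<open>M\<close> is transported by the inclusion of the circle.\<close>
  define N where "N = distr M borel id"
  have id: "id \<in> measurable M borel"
    unfolding measurable_cong_sets[OF sets_M refl] circle_borel_def id_def
    by (intro measurable_restrict_space1) simp
  have N: "emeasure N A = emeasure M A" if "A \<in> sets M" "A \<in> sets borel" for A
    using that sets.sets_into_space[OF that(1)] by (simp add: N_def emeasure_distr[OF id] Int_absorb2)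
  have "emeasure N (space N) \<noteq> \<infinity>"
    by (simp add: N_def emeasure_distr[OF id] emeasure_space_1)
  then have "emeasure N B = (SUP K \<in> {K. K \<subseteq> B \<and> compact K}. emeasure N K)"
    by (intro inner_regular Bborel) (simp_all add: N_def)
  also have "\<dots> = 0"
  proof -
    have "emeasure N K = 0" if K: "K \<subseteq> B" "compact K" for K
    proof -
      have "K \<in> sets borel" using K(2) by (simp add: compact_imp_closed)
      moreover have "B \<subseteq> sphere 0 1" using sets.sets_into_space[OF Bmeas] by (simp add: space_M)
      ultimately have Kmeas: "K \<in> sets M"
        unfolding sets_M circle_borel_def using K(1) by (subst sets_restrict_space_iff) auto
      then have "K \<in> null_sets circle_lebesgue"
        using null_sets_subset[OF B] K(1) by (simp add: sets_circle_lebesgue sets_M)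
      then have "emeasure M K = 0" by (rule null_compact_measure[OF K(2)])
      then show ?thesis using N[OF Kmeas] \<open>K \<in> sets borel\<close> by simp
    qed
    then show ?thesis by (intro antisym SUP_least) auto
  qed
  finally have "emeasure M B = 0" using N[OF Bmeas Bborel] by simp
  then show "B \<in> null_sets M" using Bmeas by (simp add: null_sets_def)
qed

end

section \<open>The Lebesgue decomposition\<close>

lemma emeasure_eq_0_if_concentrated_on_null_set:
  assumes "N \<in> sets \<nu>" "emeasure \<nu> N = 0" "emeasure \<nu> (space \<nu> - N) = 0" "B \<in> sets \<nu>"
  shows "emeasure \<nu> B = 0"
proof -
  have "N \<union> (space \<nu> - N) \<in> null_sets \<nu>"
    using assms by (intro null_sets.Un null_setsI sets.compl_sets)
  moreover have "B \<subseteq> N \<union> (space \<nu> - N)" using sets.sets_into_space[OF assms(4)] by blast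
  ultimately show ?thesis using assms(4) by (meson null_setsD1 null_sets_subset)
qed

text \<open>Both singular parts are dominated by \<open>M\<close>, hence vanish on Lebesgue null
  sets. Each is also carried by such a set, since a countable set is null, and so is 0. Conversely
  \<open>M\<close> with two zero parts is a decomposition.\<close>

lemma singular_part_of_absolutely_continuous:
  assumes sets: "sets M = sets circle_borel" and ac: "absolutely_continuous circle_lebesgue M"
  shows "is_singular_part M s \<longleftrightarrow> s = null_measure M"
proof
  assume "is_singular_part M s"
  then obtain a sc pp where s: "sets s = sets M"
      "\<And>B. B \<in> sets M \<Longrightarrow> emeasure s B = emeasure sc B + emeasure pp B"
    and dec: "lebesgue_decomposition M a sc pp"
    unfolding is_singular_part_def by blast
  note parts = dec[unfolded lebesgue_decomposition_def]
  have sets': "sets sc = sets M" "sets pp = sets M"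
    and sum: "\<forall>B\<in>sets M. emeasure M B = emeasure a B + emeasure sc B + emeasure pp B"
    and sc_null: "\<exists>N\<in>null_sets circle_lebesgue. emeasure sc (space M - N) = 0"
    and pp_countable: "\<exists>C. countable C \<and> C \<subseteq> space M \<and> emeasure pp (space M - C) = 0"
    by (rule parts[THEN conjunct1] parts[THEN conjunct2, THEN conjunct1]
      parts[THEN conjunct2, THEN conjunct2, THEN conjunct1]
      parts[THEN conjunct2, THEN conjunct2, THEN conjunct2, THEN conjunct1]
      parts[THEN conjunct2, THEN conjunct2, THEN conjunct2, THEN conjunct2, THEN conjunct2, THEN conjunct1]
      parts[THEN conjunct2, THEN conjunct2, THEN conjunct2, THEN conjunct2, THEN conjunct2, THEN conjunct2, THEN conjunct2])+
  have space: "space M = sphere 0 1"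
    using sets_eq_imp_space_eq[OF sets] by (simp add: circle_borel_def space_restrict_space)
  have null: "emeasure sc B = 0" "emeasure pp B = 0" if "B \<in> null_sets circle_lebesgue" for B
  proof -
    have "B \<in> null_sets M" using ac that by (auto simp: absolutely_continuous_def)
    then have "emeasure M B = 0" "B \<in> sets M" by auto
    then have "emeasure a B + emeasure sc B + emeasure pp B = 0" using sum by metis
    then show "emeasure sc B = 0" "emeasure pp B = 0" by auto
  qed
  obtain N where N: "N \<in> null_sets circle_lebesgue" "emeasure sc (space M - N) = 0"
    using sc_null by blast
  have sp: "space sc = space M" "space pp = space M"
    using sets'[THEN sets_eq_imp_space_eq] by simp_all
  have "N \<in> sets sc" using N(1) sets'(1) sets sets_circle_lebesgue by (metis null_setsD2)
  then have sc: "emeasure sc B = 0" if "B \<in> sets M" for B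
    using emeasure_eq_0_if_concentrated_on_null_set[of N sc B] null(1)[OF N(1)] N(2) that
    unfolding sp sets' by blast
  obtain C where C: "countable C" "C \<subseteq> space M" "emeasure pp (space M - C) = 0"
    using pp_countable by blast
  have "(\<Union>z\<in>C. {z} \<inter> sphere 0 1) \<in> null_sets circle_lebesgue"
    by (intro null_sets_UN' C circle_lebesgue_singleton)
  moreover have "(\<Union>z\<in>C. {z} \<inter> sphere 0 1) = C" using C(2) space by auto
  ultimately have Cnull: "C \<in> null_sets circle_lebesgue" by simp
  have "C \<in> sets pp" using Cnull sets'(2) sets sets_circle_lebesgue by (metis null_setsD2)
  then have pp: "emeasure pp B = 0" if "B \<in> sets M" for B
    using emeasure_eq_0_if_concentrated_on_null_set[of C pp B] null(2)[OF Cnull] C(3) that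
    unfolding sp sets' by blast
  show "s = null_measure M"
  proof (rule measure_eqI)
    show "sets s = sets (null_measure M)" using s(1) by simp
    show "emeasure s B = emeasure (null_measure M) B" if "B \<in> sets s" for B
      using that s sc pp by simp
  qed
next
  assume s: "s = null_measure M"
  have "lebesgue_decomposition M M (null_measure M) (null_measure M)"
    unfolding lebesgue_decomposition_def
    by (intro conjI ballI ac bexI[of _ "{}"] exI[of _ "{}"]) simp_all
  then show "is_singular_part M s"
    unfolding is_singular_part_def s
    by (intro conjI exI[of _ M] exI[of _ "null_measure M"]) simp_all
qed

theorem mainTheorem2:
  fixes M :: "complex measure" and \<alpha> :: "nat \<Rightarrow> complex"
  assumes "prob_space M"
    and "sets M = sets circle_borel"
    and "\<not> finitely_supported M"
    and "verblunsky_coefficients M \<alpha>"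
    and "\<exists>A::real. A \<le> 1 / 4 \<and>
           (\<forall>N::nat. N \<ge> 2 \<longrightarrow> (\<Sum>n=0..N. (real n + 1) * (cmod (\<alpha> n))\<^sup>2) \<le> A * ln (real N))"
  shows "(\<forall>s. is_singular_part M s \<longleftrightarrow> s = null_measure M) \<and>
         absolutely_continuous circle_lebesgue M"
proof -
  obtain \<Phi> where \<Phi>: "monic_orthogonal_polys M \<Phi>" "\<And>n z. z \<noteq> 0 \<Longrightarrow>
      poly (\<Phi> (Suc n)) z = z * poly (\<Phi> n) z - cnj (\<alpha> n) * szego_reversed n (\<Phi> n) z"
    using assms(4) unfolding verblunsky_coefficients_def by blast
  obtain A :: real where A: "A \<le> 1 / 4" "\<And>N::nat. N \<ge> 2 \<Longrightarrow>
      (\<Sum>n=0..N. (real n + 1) * (cmod (\<alpha> n))\<^sup>2) \<le> A * ln (real N)"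
    using assms(5) by blast
  interpret prob_space M by fact
  interpret coulomb_polys M \<Phi> \<alpha>
  proof unfold_locales
    fix N :: nat assume N: "N \<ge> 2"
    \<comment> \<open>Since \<open>ln N \<ge> 0\<close> for \<open>N \<ge> 2\<close>, the bound with
      \<open>A\<close> implies the one with 1/4.\<close>
    have "A * ln (real N) \<le> 1 / 4 * ln (real N)"
      using A(1) N by (intro mult_right_mono) auto
    then show "(\<Sum>n=0..N. (real n + 1) * (cmod (\<alpha> n))\<^sup>2) \<le> ln (real N) / 4"
      using A(2)[OF N] by simp
  qed (use assms(2) \<Phi> in auto)
  show ?thesis
    using singular_part_of_absolutely_continuous[OF assms(2) absolutely_continuous]
      absolutely_continuous by blast
qed

end
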